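(* Let $(D,M)$ be a local domain which is not a field, with quotient field $K$, and let $(M:M)=\{x\in K\mid xM\subseteq M\}$. The following are equivalent. (a) $D$ is a TAF-domain. (b) $D$ is one-dimensional and every proper principal ideal of $D$ has a TA-factorization. (c) $D$ is atomic, one-dimensional and every atom of $D$ generates a TA-ideal. (d) $D$ is atomic and $M^2$ is universal, i.e. $M^2\subseteq aD$ for each atom $a\in D$. (e) $D$ is an atomic PVD. (f) $D$ is a PVD which satisfies ACCP. (g) $(M:M)$ is a DVR with maximal ideal $M$. Moreover, if $D$ is Noetherian, then (a)–(g) are also equivalent to: (h) The integral closure $D'$ of $D$ (in $K$) is a DVR with maximal ideal $M$.
   Context: All rings are commutative with identity; "local" means having a unique maximal ideal (not necessarily Noetherian). An ideal $I$ of a ring $R$ is a 2-absorbing ideal (TA-ideal) if whenever $a,b,c\in R$ and $abc\in I$, then $ab\in I$ or $ac\in I$ or $bc\in I$. A TA-factorization of an ideal $I$ is an expression $I=J_1\cdots J_n$ as a product of proper TA-ideals. A TAF-domain is an integral domain in which every proper ideal has a TA-factorization. A local domain $(D,M)$ with quotient field $K$ is a pseudo-valuation domain (PVD) if it is a field or if $(M:M)=\{x\in K\mid xM\subseteq M\}$ is a valuation domain with maximal ideal $M$ (equivalently, for all $x,y\in K\setminus M$ one has $xy\in K\setminus M$). An atom is a nonzero nonunit that is not a product of two nonunits; a domain is atomic if every nonzero nonunit is a finite product of atoms. A domain satisfies ACCP if every ascending chain of principal ideals stabilizes. A DVR is not a field. *)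

theory Defs
  imports "HOL-Algebra.Algebra" "HOL-Library.Extended_Nat"
begin

text \<open>
  A domain with its quotient field is represented by a field \<open>K\<close> (a record) and a subset \<open>D\<close> of its
  carrier which is a subring of \<open>K\<close> and whose fractions fill \<open>K\<close>.  The domain itself, as a ring in its
  own right, is \<open>K\<lparr>carrier := D\<rparr>\<close>.  Notions that only concern the domain are defined for an arbitrary
  ring \<open>R\<close>.
\<close>

definition quotient_field :: "('a, 'b) ring_scheme \<Rightarrow> 'a set \<Rightarrow> bool" where
  "quotient_field K D \<longleftrightarrow>
     field K \<and> subring D K \<and>
     (\<forall>x\<in>carrier K. \<exists>a\<in>D. \<exists>b\<in>D - {\<zero>\<^bsub>K\<^esub>}. x = a \<otimes>\<^bsub>K\<^esub> inv\<^bsub>K\<^esub> b)"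

text \<open>\<open>M\<close> is the unique maximal ideal; no Noetherian hypothesis.\<close>

definition local_ring :: "('a, 'b) ring_scheme \<Rightarrow> 'a set \<Rightarrow> bool" where
  "local_ring R M \<longleftrightarrow> cring R \<and> maximalideal M R \<and> (\<forall>N. maximalideal N R \<longrightarrow> N = M)"

subsection \<open>2-absorbing ideals and TA-factorizations\<close>

definition proper_ideal :: "'a set \<Rightarrow> ('a, 'b) ring_scheme \<Rightarrow> bool" where
  "proper_ideal I R \<longleftrightarrow> ideal I R \<and> I \<noteq> carrier R"

definition TA_ideal :: "'a set \<Rightarrow> ('a, 'b) ring_scheme \<Rightarrow> bool" where
  "TA_ideal I R \<longleftrightarrow>
     ideal I R \<and>
     (\<forall>a\<in>carrier R. \<forall>b\<in>carrier R. \<forall>c\<in>carrier R.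
        a \<otimes>\<^bsub>R\<^esub> b \<otimes>\<^bsub>R\<^esub> c \<in> I \<longrightarrow>
        a \<otimes>\<^bsub>R\<^esub> b \<in> I \<or> a \<otimes>\<^bsub>R\<^esub> c \<in> I \<or> b \<otimes>\<^bsub>R\<^esub> c \<in> I)"

definition has_TA_factorization :: "('a, 'b) ring_scheme \<Rightarrow> 'a set \<Rightarrow> bool" where
  "has_TA_factorization R I \<longleftrightarrow>
     (\<exists>Js. Js \<noteq> [] \<and> (\<forall>J\<in>set Js. proper_ideal J R \<and> TA_ideal J R) \<and>
           I = foldr (ideal_prod R) Js (carrier R))"

definition TAF_domain :: "('a, 'b) ring_scheme \<Rightarrow> bool" where
  "TAF_domain R \<longleftrightarrow> domain R \<and> (\<forall>I. proper_ideal I R \<longrightarrow> has_TA_factorization R I)"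

subsection \<open>Krull dimension\<close>

definition krull_dim :: "('a, 'b) ring_scheme \<Rightarrow> enat" where
  "krull_dim R =
     Sup {enat n | n. \<exists>P. (\<forall>i\<le>n. primeideal (P i) R) \<and> (\<forall>i<n. P i \<subset> P (Suc i))}"

subsection \<open>Factorization of elements\<close>

definition atom :: "('a, 'b) ring_scheme \<Rightarrow> 'a \<Rightarrow> bool" where
  "atom R a \<longleftrightarrow>
     a \<in> carrier R \<and> a \<noteq> \<zero>\<^bsub>R\<^esub> \<and> a \<notin> Units R \<and>
     \<not> (\<exists>b\<in>carrier R - Units R. \<exists>c\<in>carrier R - Units R. a = b \<otimes>\<^bsub>R\<^esub> c)"

definition atomic :: "('a, 'b) ring_scheme \<Rightarrow> bool" where
  "atomic R \<longleftrightarrow>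
     (\<forall>x\<in>carrier R. x \<noteq> \<zero>\<^bsub>R\<^esub> \<longrightarrow> x \<notin> Units R \<longrightarrow>
        (\<exists>as. (\<forall>a\<in>set as. atom R a) \<and> x = foldr (\<otimes>\<^bsub>R\<^esub>) as \<one>\<^bsub>R\<^esub>))"

definition ACCP :: "('a, 'b) ring_scheme \<Rightarrow> bool" where
  "ACCP R \<longleftrightarrow>
     (\<forall>a :: nat \<Rightarrow> 'a. (\<forall>n. a n \<in> carrier R) \<longrightarrow> (\<forall>n. PIdl\<^bsub>R\<^esub> (a n) \<subseteq> PIdl\<^bsub>R\<^esub> (a (Suc n))) \<longrightarrow>
        (\<exists>N. \<forall>n\<ge>N. PIdl\<^bsub>R\<^esub> (a n) = PIdl\<^bsub>R\<^esub> (a N)))"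

definition universal_ideal :: "('a, 'b) ring_scheme \<Rightarrow> 'a set \<Rightarrow> bool" where
  "universal_ideal R I \<longleftrightarrow> (\<forall>a. atom R a \<longrightarrow> I \<subseteq> PIdl\<^bsub>R\<^esub> a)"

subsection \<open>Valuation domains, DVRs and pseudo-valuation domains\<close>

text \<open>
  Clearing denominators, the divisibility condition says that \<open>x \<in> R\<close> or \<open>1/x \<in> R\<close> for every nonzero
  \<open>x\<close> in the quotient field of \<open>R\<close>.  Fields are valuation domains.
\<close>

definition valuation_domain :: "('a, 'b) ring_scheme \<Rightarrow> bool" where
  "valuation_domain R \<longleftrightarrow>
     domain R \<and> (\<forall>a\<in>carrier R. \<forall>b\<in>carrier R. a divides\<^bsub>R\<^esub> b \<or> b divides\<^bsub>R\<^esub> a)"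

definition DVR :: "('a, 'b) ring_scheme \<Rightarrow> 'a set \<Rightarrow> bool" where
  "DVR R M \<longleftrightarrow> principal_domain R \<and> \<not> field R \<and> local_ring R M"

definition self_colon :: "('a, 'b) ring_scheme \<Rightarrow> 'a set \<Rightarrow> 'a set" where
  "self_colon K M = {x \<in> carrier K. \<forall>m\<in>M. x \<otimes>\<^bsub>K\<^esub> m \<in> M}"

definition PVD :: "('a, 'b) ring_scheme \<Rightarrow> 'a set \<Rightarrow> 'a set \<Rightarrow> bool" where
  "PVD K D M \<longleftrightarrow>
     quotient_field K D \<and> local_ring (K\<lparr>carrier := D\<rparr>) M \<and>
     (field (K\<lparr>carrier := D\<rparr>) \<or>
      (let V = K\<lparr>carrier := self_colon K M\<rparr> in valuation_domain V \<and> local_ring V M))"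

subsection \<open>Integral closure\<close>

text \<open>
  Polynomials are coefficient lists with the leading coefficient first, so the condition on \<open>hd\<close>
  makes \<open>p\<close> monic.
\<close>

definition integral_closure :: "('a, 'b) ring_scheme \<Rightarrow> 'a set \<Rightarrow> 'a set" where
  "integral_closure K D =
     {x \<in> carrier K. \<exists>p. p \<noteq> [] \<and> polynomial\<^bsub>K\<^esub> D p \<and> hd p = \<one>\<^bsub>K\<^esub> \<and> ring.eval K p x = \<zero>\<^bsub>K\<^esub>}"

end

(*
  The pivot of the equivalences is the existence of a uniformizer: p in M such that every nonzero x in M
  is u p^n with n >= 1 and u a unit of V = (M:M).  From it V is a discrete valuation ring with maximal
  ideal M, and an ideal of D with least valuation n + 1 is (pD)^n J with M^2 <= J <= M; such J are
  2-absorbing.  Conversely, in (d) the quotient of two atoms a, b is a unit of V: for m in M one has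
  b m = a d with d in D, and d is not a unit since a is an atom.

  The main difficulty is that a local TAF-domain is one-dimensional.  Every nonzero prime contains some
  t <> 0 with tD 2-absorbing, because invertible ideals are principal.  Let P < Q be primes with P nonzero
  and Q minimal over P + tD, where t is not in P and tD is 2-absorbing.  Factoring (w, y^2n) for w in P and
  y in Q - P shows that P, and likewise any prime strictly below Q, lies in all powers of Q.  If Q is
  minimal over tD, then Q^2 is contained in tD locally at Q, so some w in P with wD 2-absorbing is, up to
  an element outside Q, of the form t t z; this contradicts wD being 2-absorbing.  Otherwise t too lies in all powers of Q, and a TA-factorization of
  P + tD shows that locally some power of Q is contained in P + t^2 D, so that t is in P after all.

  In the Noetherian case V is integral over D: for x in V and nonzero m in M the ideals
  m (D + Dx + ... + Dx^n) of D stabilize.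
*)
theory Submission
  imports Defs
begin

section \<open>Prime ideals\<close>

context cring
begin

text \<open>\<open>M^2\<close> enters through polarization: a 2-absorbing ideal that contains a
  power of \<open>x\<close> contains \<open>x^2\<close>, and one that contains \<open>x^2\<close>
  and \<open>y^2\<close> contains \<open>xy\<close>. So in dimension one every nonzero proper
  2-absorbing ideal of \<open>D\<close> contains \<open>M^2\<close>, which makes the universality of
  \<open>M^2\<close> the condition to aim at. The obstacle in the dimension proof is that, without a
  Noetherian hypothesis, nothing bounds the intersection of the powers of a prime \<open>Q\<close>.
  The argument turns this around: what lies in all powers of \<open>Q\<close> is, up to a multiplier
  outside \<open>Q\<close>, divisible by \<open>t^2\<close>, exactly or modulo \<open>P\<close>, and
  this is too much both for a \<open>w\<close> that generates a 2-absorbing ideal and for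
  \<open>t\<close> itself. Localizations are not formed; such multipliers replace them, so that all
  ideals stay in one ring. Elements of \<open>M\<close> are described by units of \<open>V\<close>
  because \<open>D\<close> may be much smaller than \<open>V\<close>. The way back to
  \<open>D\<close> is always \<open>VM \<subseteq> M \<subseteq> D\<close>: one further factor from
  \<open>M\<close> absorbs a coefficient from \<open>V\<close>. This is why ideals between
  \<open>M^2\<close> and \<open>M\<close> are the natural building blocks.\<close>

lemma idealI_elementwise:
  assumes "I \<subseteq> carrier R" "\<zero> \<in> I"
    and add: "\<And>x y. x \<in> I \<Longrightarrow> y \<in> I \<Longrightarrow> x \<oplus> y \<in> I"
    and mult: "\<And>r x. r \<in> carrier R \<Longrightarrow> x \<in> I \<Longrightarrow> r \<otimes> x \<in> I"
  shows "ideal I R"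
proof (rule idealI[OF ring_axioms])
  show "subgroup I (add_monoid R)"
  proof (rule add.subgroupI)
    fix x assume x: "x \<in> I"
    then have "\<ominus> x = (\<ominus> \<one>) \<otimes> x" using assms(1) by (auto simp: l_minus)
    then show "\<ominus> x \<in> I" using mult[of "\<ominus> \<one>" x] x by simp
  qed (use assms in auto)
next
  fix a x assume "a \<in> I" "x \<in> carrier R"
  then show "x \<otimes> a \<in> I" "a \<otimes> x \<in> I"
    using mult[of x a] assms(1) m_comm[of a x] by auto
qed

lemma ideal_closed:
  assumes "ideal I R"
  shows "\<And>x. x \<in> I \<Longrightarrow> x \<in> carrier R"
    and "\<zero> \<in> I"
    and "\<And>x y. x \<in> I \<Longrightarrow> y \<in> I \<Longrightarrow> x \<oplus> y \<in> I"
    and "\<And>x y. x \<in> I \<Longrightarrow> y \<in> I \<Longrightarrow> x \<ominus> y \<in> I"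
    and "\<And>r x. r \<in> carrier R \<Longrightarrow> x \<in> I \<Longrightarrow> r \<otimes> x \<in> I"
    and "\<And>r x. r \<in> carrier R \<Longrightarrow> x \<in> I \<Longrightarrow> x \<otimes> r \<in> I"
proof -
  interpret ideal I R by fact
  show "\<And>x. x \<in> I \<Longrightarrow> x \<in> carrier R" "\<zero> \<in> I"
    "\<And>x y. x \<in> I \<Longrightarrow> y \<in> I \<Longrightarrow> x \<oplus> y \<in> I"
    "\<And>x y. x \<in> I \<Longrightarrow> y \<in> I \<Longrightarrow> x \<ominus> y \<in> I"
    by (auto simp: a_minus_def)
  show "\<And>r x. r \<in> carrier R \<Longrightarrow> x \<in> I \<Longrightarrow> r \<otimes> x \<in> I"
    "\<And>r x. r \<in> carrier R \<Longrightarrow> x \<in> I \<Longrightarrow> x \<otimes> r \<in> I"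
    by (auto intro: I_l_closed I_r_closed)
qed

lemma mem_set_add_PIdl_iff:
  "x \<in> P <+>\<^bsub>R\<^esub> PIdl a \<longleftrightarrow> (\<exists>p\<in>P. \<exists>r\<in>carrier R. x = p \<oplus> r \<otimes> a)"
  by (auto simp: set_add_def' cgenideal_def)

lemma ideal_subset_set_add:
  assumes "ideal P R" "ideal J R"
  shows "P \<subseteq> P <+>\<^bsub>R\<^esub> J" "J \<subseteq> P <+>\<^bsub>R\<^esub> J"
proof -
  show "P \<subseteq> P <+>\<^bsub>R\<^esub> J"
  proof
    fix x assume x: "x \<in> P"
    then have "x = x \<oplus> \<zero>" using ideal_closed(1)[OF assms(1)] by simp
    then show "x \<in> P <+>\<^bsub>R\<^esub> J" using x ideal_closed(2)[OF assms(2)] by (auto simp: set_add_def')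
  qed
  show "J \<subseteq> P <+>\<^bsub>R\<^esub> J"
  proof
    fix x assume x: "x \<in> J"
    then have "x = \<zero> \<oplus> x" using ideal_closed(1)[OF assms(2)] by simp
    then show "x \<in> P <+>\<^bsub>R\<^esub> J" using x ideal_closed(2)[OF assms(1)] by (auto simp: set_add_def')
  qed
qed

lemma set_add_subset_ideal:
  assumes "ideal I R" "P \<subseteq> I" "J \<subseteq> I"
  shows "P <+>\<^bsub>R\<^esub> J \<subseteq> I"
  using assms ideal_closed(3)[OF assms(1)] by (auto simp: set_add_def')

text \<open>Zorn's lemma. The set \<open>S\<close> is arbitrary because the lemma serves twice:
  multiplicative sets lead to primes, and \<open>{\<one>}\<close> leads to the maximal ideal over a
  nonunit.\<close>

lemma exists_ideal_maximal_disjoint: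
  assumes "ideal I R" "I \<inter> S = {}"
  obtains P where "ideal P R" "I \<subseteq> P" "P \<inter> S = {}"
    "\<And>J. ideal J R \<Longrightarrow> P \<subseteq> J \<Longrightarrow> J \<inter> S = {} \<Longrightarrow> J = P"
proof -
  define A where "A = {P. ideal P R \<and> I \<subseteq> P \<and> P \<inter> S = {}}"
  have "\<exists>P\<in>A. (\<forall>W\<in>A. P \<subseteq> W \<longrightarrow> W = P)"
  proof (rule subset_Zorn_nonempty)
    show "A \<noteq> {}" using assms by (auto simp: A_def)
    fix C assume C: "C \<noteq> {}" "subset.chain A C"
    then have "subset.chain {I. ideal I R} C"
      unfolding pred_on.chain_def A_def by blast
    then have "ideal (\<Union>C) R" using chain_Union_is_ideal[of C] C(1) by simp
    then show "\<Union>C \<in> A" using C unfolding pred_on.chain_def A_def by blast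
  qed
  then obtain P where P: "P \<in> A" "\<And>W. W \<in> A \<Longrightarrow> P \<subseteq> W \<Longrightarrow> W = P" by blast
  show thesis
  proof (rule that)
    fix J assume J: "ideal J R" "P \<subseteq> J" "J \<inter> S = {}"
    then have "J \<in> A" using P(1) by (auto simp: A_def)
    then show "J = P" using P(2) J(2) by blast
  qed (use P(1) in \<open>auto simp: A_def\<close>)
qed

text \<open>An ideal \<open>P\<close> maximal among those avoiding a multiplicative set is prime:
  for \<open>a\<close> and \<open>b\<close> outside \<open>P\<close>, both \<open>P + (a)\<close>
  and \<open>P + (b)\<close> meet \<open>S\<close>, say in \<open>s\<close> and \<open>t\<close>,
  and \<open>a \<otimes> b \<in> P\<close> would put \<open>s \<otimes> t\<close> into
  \<open>P\<close>.\<close>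

lemma exists_primeideal_disjoint:
  assumes "ideal I R" "I \<inter> S = {}" "S \<subseteq> carrier R" "\<one> \<in> S"
    and S: "\<And>s t. s \<in> S \<Longrightarrow> t \<in> S \<Longrightarrow> s \<otimes> t \<in> S"
  obtains P where "primeideal P R" "I \<subseteq> P" "P \<inter> S = {}"
proof -
  obtain P where P: "ideal P R" "I \<subseteq> P" "P \<inter> S = {}"
    "\<And>J. ideal J R \<Longrightarrow> P \<subseteq> J \<Longrightarrow> J \<inter> S = {} \<Longrightarrow> J = P"
    using exists_ideal_maximal_disjoint[OF assms(1,2)] by blast
  have meet: "\<exists>s\<in>S. \<exists>p\<in>P. \<exists>r\<in>carrier R. s = p \<oplus> r \<otimes> a" if a: "a \<in> carrier R" "a \<notin> P" for a
  proof (rule ccontr)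
    assume "\<not> ?thesis"
    then have "(P <+>\<^bsub>R\<^esub> PIdl a) \<inter> S = {}" by (auto simp: mem_set_add_PIdl_iff)
    moreover have "ideal (P <+>\<^bsub>R\<^esub> PIdl a) R"
      using P(1) a(1) by (intro add_ideals cgenideal_ideal)
    ultimately have "P <+>\<^bsub>R\<^esub> PIdl a = P"
      using P(4) ideal_subset_set_add(1)[OF P(1) cgenideal_ideal[OF a(1)]] by blast
    then show False
      using a cgenideal_self[OF a(1)] ideal_subset_set_add(2)[OF P(1) cgenideal_ideal[OF a(1)]]
      by blast
  qed
  have "primeideal P R"
  proof (rule primeidealI[OF P(1) is_cring])
    show "carrier R \<noteq> P" using assms(4) P(3) by auto
    fix a b assume ab: "a \<in> carrier R" "b \<in> carrier R" "a \<otimes> b \<in> P"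
    show "a \<in> P \<or> b \<in> P"
    proof (rule ccontr)
      assume "\<not> (a \<in> P \<or> b \<in> P)"
      then obtain s p r t q u where *: "s \<in> S" "p \<in> P" "r \<in> carrier R" "s = p \<oplus> r \<otimes> a"
        "t \<in> S" "q \<in> P" "u \<in> carrier R" "t = q \<oplus> u \<otimes> b"
        using meet ab(1,2) by metis
      note Pc = ideal_closed[OF P(1)]
      have c: "p \<in> carrier R" "q \<in> carrier R" using * Pc(1) by auto
      have "s \<otimes> t = p \<otimes> t \<oplus> ((r \<otimes> a) \<otimes> q \<oplus> (r \<otimes> u) \<otimes> (a \<otimes> b))"
        unfolding *(4,8) using * c ab by algebra
      moreover have "t \<in> carrier R" using * assms(3) by auto
      ultimately have "s \<otimes> t \<in> P"
        using * ab Pc by simp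
      then show False using S[OF *(1,5)] P(3) by blast
    qed
  qed
  then show thesis using that P by blast
qed

text \<open>The intersection of a chain of primes is prime: if it misses \<open>a\<close> and
  \<open>b\<close>, then by comparability one member of the chain misses both.\<close>

lemma exists_minimal_primeideal:
  assumes "primeideal P0 R" "I \<subseteq> P0"
  obtains Q where "primeideal Q R" "I \<subseteq> Q" "Q \<subseteq> P0"
    "\<And>P. primeideal P R \<Longrightarrow> I \<subseteq> P \<Longrightarrow> P \<subseteq> Q \<Longrightarrow> P = Q"
proof -
  \<comment> \<open>Complements turn intersections of chains into unions, so that Zorn's lemma for
    unions applies; a maximal complement belongs to a minimal prime.\<close>
  define A where "A = {carrier R - Q | Q. primeideal Q R \<and> I \<subseteq> Q \<and> Q \<subseteq> P0}"
  have pc: "Q \<subseteq> carrier R" if "primeideal Q R" for Q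
    using that ideal_closed(1) by (auto simp: primeideal_def)
  have "\<exists>W\<in>A. (\<forall>Y\<in>A. W \<subseteq> Y \<longrightarrow> Y = W)"
  proof (rule subset_Zorn_nonempty)
    show "A \<noteq> {}" using assms by (auto simp: A_def)
    fix C assume C: "C \<noteq> {}" "subset.chain A C"
    define Q where "Q = carrier R - \<Union>C"
    have CA: "\<And>W. W \<in> C \<Longrightarrow> \<exists>Q. primeideal Q R \<and> I \<subseteq> Q \<and> Q \<subseteq> P0 \<and> W = carrier R - Q"
      using C(2) by (auto simp: subset_chain_def A_def)
    have lin: "\<And>W Y. W \<in> C \<Longrightarrow> Y \<in> C \<Longrightarrow> W \<subseteq> Y \<or> Y \<subseteq> W"
      using C(2) by (auto simp: subset_chain_def)
    have prime: "primeideal (carrier R - W) R" if W: "W \<in> C" for W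
      using CA[OF W] pc by (auto simp: double_diff)
    then have idl: "ideal (carrier R - W) R" if "W \<in> C" for W
      using that by (auto simp: primeideal_def)
    have "primeideal Q R"
    proof (rule primeidealI[OF _ is_cring])
      show "ideal Q R"
      proof (rule idealI_elementwise)
        show "\<zero> \<in> Q" using ideal_closed(2)[OF idl] by (auto simp: Q_def)
        show "x \<oplus> y \<in> Q" if "x \<in> Q" "y \<in> Q" for x y
          using that ideal_closed(3)[OF idl] by (auto simp: Q_def)
        show "r \<otimes> x \<in> Q" if "r \<in> carrier R" "x \<in> Q" for r x
          using that ideal_closed(5)[OF idl] by (auto simp: Q_def)
      qed (auto simp: Q_def)
      obtain W where W: "W \<in> C" using C(1) by blast
      then have "\<one> \<in> W"
        using primeideal.I_notcarr[OF prime[OF W]] ideal.one_imp_carrier[OF idl[OF W]] by blast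
      then show "carrier R \<noteq> Q" using W one_closed by (auto simp: Q_def)
      fix a b assume ab: "a \<in> carrier R" "b \<in> carrier R" "a \<otimes> b \<in> Q"
      show "a \<in> Q \<or> b \<in> Q"
      proof (rule ccontr)
        assume "\<not> ?thesis"
        then obtain W Y where XY: "W \<in> C" "Y \<in> C" "a \<in> W" "b \<in> Y" using ab by (auto simp: Q_def)
        obtain Z where Z: "Z \<in> C" "a \<in> Z" "b \<in> Z" using lin[OF XY(1,2)] XY by blast
        then have "a \<otimes> b \<in> carrier R - Z" using ab(3) by (auto simp: Q_def)
        then show False using primeideal.I_prime[OF prime[OF Z(1)] ab(1,2)] Z by blast
      qed
    qed
    moreover have "I \<subseteq> Q"
    proof
      fix x assume x: "x \<in> I"
      have "x \<in> carrier R" using x assms pc by blast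
      moreover have "x \<notin> W" if "W \<in> C" for W using CA[OF that] x by auto
      ultimately show "x \<in> Q" by (auto simp: Q_def)
    qed
    moreover have "Q \<subseteq> P0"
    proof -
      obtain W where W: "W \<in> C" using C(1) by blast
      then obtain Q' where "Q' \<subseteq> P0" "W = carrier R - Q'" using CA by blast
      then show ?thesis using W by (auto simp: Q_def)
    qed
    moreover have "\<Union>C = carrier R - Q" using CA by (auto simp: Q_def)
    ultimately show "\<Union>C \<in> A" by (auto simp: A_def)
  qed
  then obtain Q where Q: "primeideal Q R" "I \<subseteq> Q" "Q \<subseteq> P0"
    and max: "\<And>Y. Y \<in> A \<Longrightarrow> carrier R - Q \<subseteq> Y \<Longrightarrow> Y = carrier R - Q"
    by (auto simp: A_def)
  show thesis
  proof (rule that[OF Q])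
    fix P assume P: "primeideal P R" "I \<subseteq> P" "P \<subseteq> Q"
    then have "carrier R - P \<in> A" using Q(3) by (auto simp: A_def)
    then have "carrier R - P = carrier R - Q" using max P(3) by blast
    then show "P = Q" using pc[OF P(1)] pc[OF Q(1)] by blast
  qed
qed

text \<open>In the localization at \<open>Q\<close> the prime \<open>Q\<close> is the only one over
  \<open>I\<close>, so \<open>x\<close> is nilpotent modulo \<open>I\<close> there. Without
  localizing: if \<open>I\<close> missed all \<open>s \<otimes> x [^] n\<close> with
  \<open>s\<close> outside \<open>Q\<close>, a prime over \<open>I\<close> avoiding this
  multiplicative set would lie below \<open>Q\<close> and miss \<open>x\<close>, against
  minimality.\<close>

lemma minimal_primeideal_nilpotent:
  assumes Q: "primeideal Q R" and I: "ideal I R"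
    and min: "\<And>P. primeideal P R \<Longrightarrow> I \<subseteq> P \<Longrightarrow> P \<subseteq> Q \<Longrightarrow> P = Q"
    and x: "x \<in> Q"
  obtains s and n :: nat where "s \<in> carrier R - Q" "s \<otimes> x [^] n \<in> I"
proof -
  have Qi: "ideal Q R" using Q by (simp add: primeideal_def)
  note Qc = ideal_closed[OF Qi]
  define S where "S = {s \<otimes> x [^] n | s n. s \<in> carrier R - Q \<and> (n::nat) \<in> UNIV}"
  have one: "\<one> \<notin> Q" using primeideal.I_notcarr[OF Q] ideal.one_imp_carrier[OF Qi] by blast
  have xc: "x \<in> carrier R" using Qc(1) x .
  have "I \<inter> S \<noteq> {}"
  proof
    assume disj: "I \<inter> S = {}"
    have Sc: "S \<subseteq> carrier R" using xc by (auto simp: S_def)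
    have sub: "s \<in> S" if "s \<in> carrier R - Q" for s
    proof -
      have "s = s \<otimes> x [^] (0::nat)" using that by simp
      then show ?thesis using that unfolding S_def by blast
    qed
    have S1: "\<one> \<in> S" using one sub by blast
    have xS: "x \<in> S"
    proof -
      have "x = \<one> \<otimes> x [^] (1::nat)" using xc by simp
      then show ?thesis using one unfolding S_def by blast
    qed
    have mult: "s \<otimes> t \<in> S" if "s \<in> S" "t \<in> S" for s t
    proof -
      obtain a b and m n :: nat where *: "a \<in> carrier R - Q" "b \<in> carrier R - Q"
        "s = a \<otimes> x [^] m" "t = b \<otimes> x [^] n" using \<open>s \<in> S\<close> \<open>t \<in> S\<close> unfolding S_def by blast
      have "s \<otimes> t = (a \<otimes> b) \<otimes> x [^] (m + n)"
        unfolding * using *(1,2) xc by (simp add: nat_pow_mult[symmetric] m_ac)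
      moreover have "a \<otimes> b \<in> carrier R - Q"
        using *(1,2) primeideal.I_prime[OF Q] by blast
      ultimately show ?thesis unfolding S_def by blast
    qed
    obtain P where P: "primeideal P R" "I \<subseteq> P" "P \<inter> S = {}"
      using exists_primeideal_disjoint[OF I disj Sc S1 mult] by blast
    have "P \<subseteq> Q"
      using P(3) sub ideal_closed(1)[of P] P(1) by (auto simp: primeideal_def)
    then have "P = Q" using min P by blast
    then show False using x xS P(3) by blast
  qed
  then show thesis using that unfolding S_def by blast
qed

end

section \<open>Ideal products, localization and 2-absorbing ideals\<close>

abbreviation ideal_prod_list :: "('a, 'b) ring_scheme \<Rightarrow> 'a set list \<Rightarrow> 'a set" where
  "ideal_prod_list R Js \<equiv> foldr (ideal_prod R) Js (carrier R)"

definition ideal_power :: "('a, 'b) ring_scheme \<Rightarrow> 'a set \<Rightarrow> nat \<Rightarrow> 'a set" where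
  "ideal_power R I n = ideal_prod_list R (replicate n I)"

text \<open>For ideals this says that the extension of \<open>A\<close> to the localization of \<open>R\<close> at the prime \<open>Q\<close>
  is contained in that of \<open>B\<close>.\<close>

definition loc_subset :: "('a, 'b) ring_scheme \<Rightarrow> 'a set \<Rightarrow> 'a set \<Rightarrow> 'a set \<Rightarrow> bool" where
  "loc_subset R Q A B \<longleftrightarrow> (\<forall>x\<in>A. \<exists>s\<in>carrier R - Q. s \<otimes>\<^bsub>R\<^esub> x \<in> B)"

context cring
begin

lemma ideal_power_0: "ideal_power R I 0 = carrier R"
  and ideal_power_Suc: "ideal_power R I (Suc n) = I \<cdot> ideal_power R I n"
  by (simp_all add: ideal_power_def)

lemma ideal_prod_list_ideal:
  "\<forall>J\<in>set Js. ideal J R \<Longrightarrow> ideal (ideal_prod_list R Js) R"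
  by (induction Js) (auto intro: oneideal ideal_prod_is_ideal)

lemma ideal_power_ideal: "ideal I R \<Longrightarrow> ideal (ideal_power R I n) R"
  unfolding ideal_power_def by (rule ideal_prod_list_ideal) auto

lemma ideal_prod_subset:
  assumes "ideal I R" "\<And>a b. a \<in> A \<Longrightarrow> b \<in> B \<Longrightarrow> a \<otimes> b \<in> I"
  shows "A \<cdot> B \<subseteq> I"
proof
  fix x assume "x \<in> A \<cdot> B"
  then show "x \<in> I" by induction (use assms ideal_closed(3) in auto)
qed

lemma ideal_prod_mono:
  assumes "A \<subseteq> B" "C \<subseteq> D"
  shows "A \<cdot> C \<subseteq> B \<cdot> D"
proof
  fix x assume "x \<in> A \<cdot> C"
  then show "x \<in> B \<cdot> D"
    by induction (use assms in \<open>auto intro: ideal_prod.intros\<close>)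
qed

lemma ideal_prod_list_subset_mem:
  assumes "\<forall>J\<in>set Js. ideal J R" "J \<in> set Js"
  shows "ideal_prod_list R Js \<subseteq> J"
  using assms
proof (induction Js)
  case (Cons I Js)
  then have "I \<cdot> ideal_prod_list R Js \<subseteq> I \<inter> ideal_prod_list R Js"
    by (intro ideal_prod_inter ideal_prod_list_ideal) auto
  with Cons show ?case by auto
qed simp

lemma primeideal_ideal_prod_list:
  assumes Q: "primeideal Q R" and "ideal_prod_list R Js \<subseteq> Q" "\<forall>J\<in>set Js. ideal J R"
  obtains J where "J \<in> set Js" "J \<subseteq> Q"
proof -
  have "\<exists>J\<in>set Js. J \<subseteq> Q" using assms(2,3)
  proof (induction Js)
    case Nil
    then show ?case
      using primeideal.I_notcarr[OF Q] ideal_closed(1)[of Q] Q by (auto simp: primeideal_def)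
  next
    case (Cons I Js)
    show ?case
    proof (cases "I \<subseteq> Q")
      case False
      then obtain a where a: "a \<in> I" "a \<notin> Q" by blast
      have "ideal_prod_list R Js \<subseteq> Q"
      proof
        fix b assume b: "b \<in> ideal_prod_list R Js"
        have "a \<otimes> b \<in> Q" using Cons.prems(1) ideal_prod.prod[OF a(1) b] by auto
        moreover have "a \<in> carrier R" "b \<in> carrier R"
          using a b Cons.prems(2) ideal_closed(1)[of I] ideal_closed(1)[OF ideal_prod_list_ideal]
          by auto
        ultimately show "b \<in> Q" using primeideal.I_prime[OF Q] a(2) by blast
      qed
      with Cons show ?thesis by auto
    qed auto
  qed
  then show thesis using that by blast
qed

lemma ideal_power_add:
  assumes "ideal I R"
  shows "ideal_power R I (m + n) = ideal_power R I m \<cdot> ideal_power R I n"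
proof (induction m)
  case 0
  then show ?case
    using ideal_prod_commute[OF oneideal ideal_power_ideal[OF assms, of n]]
      ideal_prod_one[OF ideal_power_ideal[OF assms, of n]]
    by (simp add: ideal_power_0)
next
  case (Suc m)
  then show ?case
    by (simp add: ideal_power_Suc ideal_prod_assoc[OF assms] ideal_power_ideal assms)
qed

lemma ideal_power_antimono:
  assumes "ideal I R" "m \<le> n"
  shows "ideal_power R I n \<subseteq> ideal_power R I m"
proof -
  have "ideal_power R I n = ideal_power R I m \<cdot> ideal_power R I (n - m)"
    using assms ideal_power_add[OF assms(1), of m "n - m"] by simp
  then show ?thesis
    using ideal_prod_inter[OF ideal_power_ideal ideal_power_ideal, OF assms(1,1)] by blast
qed

section \<open>Inclusions locally at a prime\<close>

lemma primeideal_closed: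
  assumes "primeideal Q R"
  shows "ideal Q R" "\<one> \<notin> Q"
    "\<And>a b. a \<in> carrier R - Q \<Longrightarrow> b \<in> carrier R - Q \<Longrightarrow> a \<otimes> b \<in> carrier R - Q"
proof -
  show i: "ideal Q R" using assms by (simp add: primeideal_def)
  show "\<one> \<notin> Q" using primeideal.I_notcarr[OF assms] ideal.one_imp_carrier[OF i] by blast
  show "\<And>a b. a \<in> carrier R - Q \<Longrightarrow> b \<in> carrier R - Q \<Longrightarrow> a \<otimes> b \<in> carrier R - Q"
    using primeideal.I_prime[OF assms] by blast
qed

text \<open>Elements of an ideal product arise from products by addition. For a sum the two
  multipliers are multiplied, and primality of \<open>Q\<close> keeps the result outside
  \<open>Q\<close>, so it is enough to treat generators.\<close>

lemma loc_subset_prod: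
  assumes Q: "primeideal Q R" and "ideal A R" "ideal C R" and B: "ideal B R"
    and *: "\<And>a c. a \<in> A \<Longrightarrow> c \<in> C \<Longrightarrow> \<exists>s\<in>carrier R - Q. s \<otimes> (a \<otimes> c) \<in> B"
  shows "loc_subset R Q (A \<cdot> C) B"
  unfolding loc_subset_def
proof
  fix x assume "x \<in> A \<cdot> C"
  then show "\<exists>s\<in>carrier R - Q. s \<otimes> x \<in> B"
  proof induction
    case (sum x y)
    then obtain s t where st: "s \<in> carrier R - Q" "t \<in> carrier R - Q" "s \<otimes> x \<in> B" "t \<otimes> y \<in> B"
      by blast
    have "x \<in> carrier R" "y \<in> carrier R"
      using sum.hyps ideal_prod_in_carrier[OF assms(2,3)] by auto
    then have "(s \<otimes> t) \<otimes> (x \<oplus> y) = t \<otimes> (s \<otimes> x) \<oplus> s \<otimes> (t \<otimes> y)"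
      using st by (simp add: r_distr m_ac)
    then have "(s \<otimes> t) \<otimes> (x \<oplus> y) \<in> B" using st ideal_closed[OF B] by auto
    then show ?case using primeideal_closed(3)[OF Q st(1,2)] by blast
  qed (use * in blast)
qed

lemma loc_subset_prod_mono:
  assumes Q: "primeideal Q R" and I: "ideal A R" "ideal B R" "ideal C R" "ideal D R"
    and AB: "loc_subset R Q A B" and CD: "loc_subset R Q C D"
  shows "loc_subset R Q (A \<cdot> C) (B \<cdot> D)"
proof (rule loc_subset_prod[OF Q I(1,3) ideal_prod_is_ideal[OF I(2,4)]])
  fix a c assume ac: "a \<in> A" "c \<in> C"
  then obtain s t where st: "s \<in> carrier R - Q" "t \<in> carrier R - Q" "s \<otimes> a \<in> B" "t \<otimes> c \<in> D"
    using AB CD unfolding loc_subset_def by blast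
  have "(s \<otimes> t) \<otimes> (a \<otimes> c) = (s \<otimes> a) \<otimes> (t \<otimes> c)"
    using st ac ideal_closed(1)[OF I(1)] ideal_closed(1)[OF I(3)] by (simp add: m_ac)
  then have "(s \<otimes> t) \<otimes> (a \<otimes> c) \<in> B \<cdot> D" using st by (simp add: ideal_prod.prod)
  then show "\<exists>s\<in>carrier R - Q. s \<otimes> (a \<otimes> c) \<in> B \<cdot> D"
    using primeideal_closed(3)[OF Q st(1,2)] by blast
qed

text \<open>Factors not contained in \<open>Q\<close> only shrink the product, so the number of
  factors inside \<open>Q\<close> is a lower bound for its order along \<open>Q\<close>.\<close>

lemma ideal_prod_list_subset_power:
  assumes Q: "primeideal Q R" and "\<forall>J\<in>set Js. ideal J R"
  shows "ideal_prod_list R Js \<subseteq> ideal_power R Q (length (filter (\<lambda>J. J \<subseteq> Q) Js))"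
  using assms(2)
proof (induction Js)
  case (Cons J Js)
  let ?k = "length (filter (\<lambda>J. J \<subseteq> Q) Js)"
  have IH: "ideal_prod_list R Js \<subseteq> ideal_power R Q ?k" using Cons by simp
  show ?case
  proof (cases "J \<subseteq> Q")
    case True
    then show ?thesis using ideal_prod_mono[OF True IH] by (simp add: ideal_power_Suc)
  next
    case False
    have "J \<cdot> ideal_prod_list R Js \<subseteq> ideal_prod_list R Js"
      using Cons.prems ideal_prod_inter[of J, OF _ ideal_prod_list_ideal[of Js]] by auto
    then show ?thesis using IH False by simp
  qed
qed (simp add: ideal_power_0)

text \<open>The estimate opposite to \<open>ideal_prod_list_subset_power\<close>: a factor not
  contained in \<open>Q\<close> becomes the unit ideal locally, and each remaining one costs at most
  \<open>Q^2\<close>, whence the 2 in the exponent.\<close>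

lemma loc_subset_ideal_prod_list:
  assumes Q: "primeideal Q R" and "\<forall>J\<in>set Js. ideal J R"
    and "\<And>J. J \<in> set Js \<Longrightarrow> J \<subseteq> Q \<Longrightarrow> loc_subset R Q (Q \<cdot> Q) J"
  shows "loc_subset R Q (ideal_power R Q (2 * length (filter (\<lambda>J. J \<subseteq> Q) Js)))
    (ideal_prod_list R Js)"
  using assms(2,3)
proof (induction Js)
  case Nil
  then show ?case using primeideal_closed(2)[OF Q]
    by (auto simp: loc_subset_def ideal_power_0 intro!: bexI[of _ \<one>])
next
  case (Cons J Js)
  let ?k = "2 * length (filter (\<lambda>J. J \<subseteq> Q) Js)"
  note Qi = primeideal_closed(1)[OF Q]
  have IH: "loc_subset R Q (ideal_power R Q ?k) (ideal_prod_list R Js)" using Cons by simp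
  have J: "ideal J R" "ideal (ideal_prod_list R Js) R"
    using Cons.prems(1) ideal_prod_list_ideal[of Js] by auto
  note Pi = ideal_power_ideal[OF Qi, of ?k]
  show ?case
  proof (cases "J \<subseteq> Q")
    case True
    have "loc_subset R Q ((Q \<cdot> Q) \<cdot> ideal_power R Q ?k) (J \<cdot> ideal_prod_list R Js)"
      using Cons.prems True
      by (intro loc_subset_prod_mono[OF Q] IH ideal_prod_is_ideal Qi Pi J) auto
    moreover have "ideal_power R Q (Suc (Suc ?k)) = (Q \<cdot> Q) \<cdot> ideal_power R Q ?k"
      by (simp add: ideal_power_Suc ideal_prod_assoc Qi Pi)
    ultimately show ?thesis using True by simp
  next
    case False
    then obtain s where s: "s \<in> J" "s \<in> carrier R - Q" using ideal_closed(1)[OF J(1)] by blast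
    then have "loc_subset R Q (carrier R) J"
      unfolding loc_subset_def using ideal_closed(6)[OF J(1)] by blast
    then have "loc_subset R Q (carrier R \<cdot> ideal_power R Q ?k) (J \<cdot> ideal_prod_list R Js)"
      by (intro loc_subset_prod_mono[OF Q] IH oneideal Pi J)
    then show ?thesis using False ideal_prod_commute[OF oneideal Pi] ideal_prod_one[OF Pi] by simp
  qed
qed

section \<open>2-absorbing ideals at their minimal primes\<close>

lemma TA_ideal_power_mem:
  assumes J: "TA_ideal J R" and x: "x \<in> carrier R"
  shows "x [^] (n::nat) \<in> J \<Longrightarrow> x \<otimes> x \<in> J"
proof (induction n)
  case 0
  have "ideal J R" using J by (simp add: TA_ideal_def)
  then show ?case using 0 ideal_closed(5)[of J "x \<otimes> x" \<one>] x by simp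
next
  case (Suc n)
  have Ji: "ideal J R" using J by (simp add: TA_ideal_def)
  show ?case
  proof (cases n)
    case 0
    then show ?thesis using Suc.prems x ideal_closed(5)[OF Ji] by simp
  next
    case (Suc m)
    \<comment> \<open>With \<open>x [^] Suc n\<close> read as the product of \<open>x\<close>,
      \<open>x\<close> and \<open>x [^] m\<close>, two of the three outcomes of the 2-absorbing
      property coincide: either \<open>x \<otimes> x\<close> lies in \<open>J\<close>, or the
      exponent drops by one.\<close>
    then have eq: "x [^] n = x \<otimes> x [^] m" "x [^] Suc n = x \<otimes> x \<otimes> x [^] m"
      using x by (simp_all add: m_ac)
    then have "x \<otimes> x \<in> J \<or> x [^] n \<in> J"
      using J x Suc.prems unfolding TA_ideal_def by (metis nat_pow_closed)
    then show ?thesis using Suc.IH by blast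
  qed
qed

text \<open>Apply the 2-absorbing property to \<open>x \<otimes> y \<otimes> (x \<oplus> y)\<close>.\<close>

lemma TA_ideal_prod_mem:
  assumes J: "TA_ideal J R" and xy: "x \<in> carrier R" "y \<in> carrier R"
    and "x \<otimes> x \<in> J" "y \<otimes> y \<in> J"
  shows "x \<otimes> y \<in> J"
proof -
  have Ji: "ideal J R" using J by (simp add: TA_ideal_def)
  note Jc = ideal_closed[OF Ji]
  have "x \<otimes> y \<otimes> (x \<oplus> y) = y \<otimes> (x \<otimes> x) \<oplus> x \<otimes> (y \<otimes> y)" using xy by algebra
  then have "x \<otimes> y \<otimes> (x \<oplus> y) \<in> J" using assms Jc by simp
  then consider "x \<otimes> y \<in> J" | "x \<otimes> (x \<oplus> y) \<in> J" | "y \<otimes> (x \<oplus> y) \<in> J"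
    using J xy unfolding TA_ideal_def by (meson a_closed)
  then show ?thesis
  proof cases
    case 2
    have "x \<otimes> y = x \<otimes> (x \<oplus> y) \<ominus> x \<otimes> x" using xy by algebra
    then show ?thesis using Jc(4)[OF 2 assms(4)] by simp
  next
    case 3
    have "x \<otimes> y = y \<otimes> (x \<oplus> y) \<ominus> y \<otimes> y" using xy by algebra
    then show ?thesis using Jc(4)[OF 3 assms(5)] by simp
  qed
qed

text \<open>Locally at \<open>Q\<close> every element of \<open>Q\<close> is nilpotent modulo
  \<open>J\<close>. Being 2-absorbing, \<open>J\<close> then contains the squares, and from the
  squares it gets the mixed products.\<close>

lemma TA_ideal_loc_subset:
  assumes Q: "primeideal Q R" and J: "TA_ideal J R"
    and min: "\<And>P. primeideal P R \<Longrightarrow> J \<subseteq> P \<Longrightarrow> P \<subseteq> Q \<Longrightarrow> P = Q"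
  shows "loc_subset R Q (Q \<cdot> Q) J"
proof (rule loc_subset_prod[OF Q])
  show Ji: "ideal J R" using J by (simp add: TA_ideal_def)
  note Jc = ideal_closed[OF Ji]
  show Qi: "ideal Q R" "ideal Q R" using primeideal_closed(1)[OF Q] by auto
  have *: "\<exists>s\<in>carrier R - Q. (s \<otimes> x) \<otimes> (s \<otimes> x) \<in> J" if x: "x \<in> Q" for x
  proof -
    obtain s and n :: nat where s: "s \<in> carrier R - Q" "s \<otimes> x [^] n \<in> J"
      using minimal_primeideal_nilpotent[OF Q Ji min x] by blast
    have xc: "x \<in> carrier R" using ideal_closed(1)[OF Qi(1)] x .
    \<comment> \<open>The exponent \<open>Suc n\<close> leaves one factor \<open>s\<close> to pair
      with \<open>x [^] n\<close> also when \<open>n = 0\<close>.\<close>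
    have "(s \<otimes> x) [^] Suc n = (s [^] n \<otimes> x) \<otimes> (s \<otimes> x [^] n)"
      using s xc by (simp add: nat_pow_distrib m_ac)
    then have "(s \<otimes> x) [^] Suc n \<in> J" using s xc Jc(5) by simp
    then show ?thesis using TA_ideal_power_mem[OF J, of "s \<otimes> x" "Suc n"] s xc by blast
  qed
  fix a c assume ac: "a \<in> Q" "c \<in> Q"
  then obtain s t where st: "s \<in> carrier R - Q" "t \<in> carrier R - Q"
    "(s \<otimes> a) \<otimes> (s \<otimes> a) \<in> J" "(t \<otimes> c) \<otimes> (t \<otimes> c) \<in> J" using * by blast
  have acc: "a \<in> carrier R" "c \<in> carrier R" using ac ideal_closed(1)[OF Qi(1)] by auto
  have "(s \<otimes> a) \<otimes> (t \<otimes> c) \<in> J" using TA_ideal_prod_mem[OF J _ _ st(3,4)] st acc by simp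
  moreover have "(s \<otimes> a) \<otimes> (t \<otimes> c) = (s \<otimes> t) \<otimes> (a \<otimes> c)" using st acc by (simp add: m_ac)
  ultimately show "\<exists>s\<in>carrier R - Q. s \<otimes> (a \<otimes> c) \<in> J"
    using primeideal_closed(3)[OF Q st(1,2)] by auto
qed

text \<open>A factor inside \<open>Q\<close> receives \<open>y \<otimes> y\<close>, any other factor
  an element outside \<open>Q\<close>. The exponent thus counts the factors inside \<open>Q\<close>,
  which is how their number is bounded from below later.\<close>

lemma exists_mult_power_mem_ideal_prod_list:
  assumes Q: "primeideal Q R" and "\<forall>J\<in>set Js. ideal J R" and y: "y \<in> carrier R"
    and "\<And>J. J \<in> set Js \<Longrightarrow> J \<subseteq> Q \<Longrightarrow> y \<otimes> y \<in> J"
  shows "\<exists>s\<in>carrier R - Q.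
    s \<otimes> y [^] (2 * length (filter (\<lambda>J. J \<subseteq> Q) Js)) \<in> ideal_prod_list R Js"
  using assms(2,4)
proof (induction Js)
  case Nil
  then show ?case using primeideal_closed(2)[OF Q] by (auto intro!: bexI[of _ \<one>])
next
  case (Cons J Js)
  let ?k = "2 * length (filter (\<lambda>J. J \<subseteq> Q) Js)"
  obtain s where s: "s \<in> carrier R - Q" "s \<otimes> y [^] ?k \<in> ideal_prod_list R Js"
    using Cons by auto
  show ?case
  proof (cases "J \<subseteq> Q")
    case True
    then have "(y \<otimes> y) \<otimes> (s \<otimes> y [^] ?k) \<in> J \<cdot> ideal_prod_list R Js"
      using Cons.prems s by (intro ideal_prod.prod) auto
    moreover have "(y \<otimes> y) \<otimes> (s \<otimes> y [^] ?k) = s \<otimes> y [^] (Suc (Suc ?k))"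
      using s y by (simp add: m_ac)
    ultimately show ?thesis using True s by auto
  next
    case False
    then obtain t where t: "t \<in> J" "t \<in> carrier R - Q"
      using Cons.prems(1) ideal_closed(1)[of J] by auto
    have "t \<otimes> (s \<otimes> y [^] ?k) \<in> J \<cdot> ideal_prod_list R Js" using s t by (intro ideal_prod.prod)
    moreover have "t \<otimes> (s \<otimes> y [^] ?k) = (t \<otimes> s) \<otimes> y [^] ?k" using s t y by (simp add: m_ac)
    ultimately show ?thesis using False primeideal_closed(3)[OF Q t(2) s(1)] by auto
  qed
qed

end

section \<open>The dimension of TAF-domains\<close>

lemma (in cring) TA_factorizationE:
  assumes "has_TA_factorization R I"
  obtains Js where "Js \<noteq> []" "\<And>J. J \<in> set Js \<Longrightarrow> proper_ideal J R" "\<And>J. J \<in> set Js \<Longrightarrow> TA_ideal J R"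
    "\<forall>J\<in>set Js. ideal J R" "I = ideal_prod_list R Js"
  using assms unfolding has_TA_factorization_def TA_ideal_def by blast

lemma (in cring) proper_ideal_subset_primeideal:
  assumes "ideal I R" "I \<subseteq> Q" "primeideal Q R"
  shows "proper_ideal I R"
  using assms primeideal_closed(2)[OF assms(3)] one_closed by (auto simp: proper_ideal_def)

lemma (in cring) PIdl_memI: "r \<in> carrier R \<Longrightarrow> r \<otimes> a \<in> PIdl a"
  by (auto simp: cgenideal_def)

text \<open>Factor \<open>(w) + (y^2n)\<close>, where \<open>w \<in> P\<close> and \<open>y \<in> Q - P\<close>: each factor contains \<open>y^2\<close>, hence, comparing
  powers of \<open>y\<close> modulo \<open>P\<close>, at least \<open>n\<close> factors are contained in \<open>Q\<close>.\<close>

lemma (in cring) primeideal_subset_ideal_power: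
  assumes fact: "\<And>I. proper_ideal I R \<Longrightarrow> has_TA_factorization R I"
    and P: "primeideal P R" and Q: "primeideal Q R" and PQ: "P \<subseteq> Q" "P \<noteq> Q"
  shows "P \<subseteq> ideal_power R Q n"
proof (cases "n = 0")
  case True
  then show ?thesis using ideal_closed(1)[OF primeideal_closed(1)[OF P]] by (auto simp: ideal_power_0)
next
  \<comment> \<open>For \<open>n = 0\<close> the element \<open>y [^] (2 * n)\<close> would be one
    and the ideal \<open>I\<close> below would not be proper.\<close>
  case n: False
  note Qi = primeideal_closed(1)[OF Q] and Pi = primeideal_closed(1)[OF P]
  obtain y where y: "y \<in> Q" "y \<notin> P" using PQ by blast
  have yc: "y \<in> carrier R" using ideal_closed(1)[OF Qi] y by blast
  have yP: "y [^] (m::nat) \<notin> P" for m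
  proof (induction m)
    case 0
    then show ?case using primeideal_closed(2)[OF P] by simp
  next
    case (Suc m)
    then show ?case using primeideal.I_prime[OF P, of "y [^] m" y] y yc by auto
  qed
  show ?thesis
  proof
    fix w assume w: "w \<in> P"
    then have wc: "w \<in> carrier R" using ideal_closed(1)[OF Pi] by blast
    let ?z = "y [^] (2 * n)"
    define I where "I = PIdl w <+>\<^bsub>R\<^esub> PIdl ?z"
    have Ii: "ideal I R" unfolding I_def using wc yc by (intro add_ideals cgenideal_ideal) auto
    have sub: "PIdl w \<subseteq> I" "PIdl ?z \<subseteq> I" unfolding I_def
      using wc yc by (intro ideal_subset_set_add cgenideal_ideal; simp)+
    have "?z = y [^] (2 * n - 1) \<otimes> y"
      using yc n by (metis Suc_diff_1 mult_pos_pos neq0_conv nat_pow_Suc zero_less_numeral)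
    then have "?z \<in> Q" using ideal_closed(5)[OF Qi _ y(1)] yc by simp
    then have "I \<subseteq> Q" unfolding I_def using w PQ
      by (intro set_add_subset_ideal[OF Qi] cgenideal_minimal[OF Qi]) auto
    then have "has_TA_factorization R I" using fact proper_ideal_subset_primeideal Ii Q by blast
    then obtain Js where Js: "\<And>J. J \<in> set Js \<Longrightarrow> TA_ideal J R" "\<forall>J\<in>set Js. ideal J R"
      "I = ideal_prod_list R Js" by (rule TA_factorizationE) blast
    define k where "k = length (filter (\<lambda>J. J \<subseteq> Q) Js)"
    have "y \<otimes> y \<in> J" if J: "J \<in> set Js" for J
    proof -
      have "?z \<in> PIdl ?z" using cgenideal_self yc by simp
      then have "?z \<in> J" using sub(2) Js(3) ideal_prod_list_subset_mem[OF Js(2) J] by blast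
      then show ?thesis using TA_ideal_power_mem[OF Js(1)[OF J] yc] by blast
    qed
    then obtain s where s: "s \<in> carrier R - Q" "s \<otimes> y [^] (2 * k) \<in> I"
      using exists_mult_power_mem_ideal_prod_list[OF Q Js(2) yc] Js(3) unfolding k_def by blast
    have "n \<le> k"
    proof (rule ccontr)
      assume "\<not> n \<le> k"
      then have less: "k < n" by simp
      obtain p r where pr: "p \<in> PIdl w" "r \<in> carrier R" "s \<otimes> y [^] (2 * k) = p \<oplus> r \<otimes> ?z"
        using s(2) by (auto simp: I_def mem_set_add_PIdl_iff)
      have p: "p \<in> P" using pr(1) cgenideal_minimal[OF Pi w] by blast
      \<comment> \<open>By the choice of \<open>d\<close>, the power \<open>?z\<close> has at least
        one factor \<open>y\<close> more than \<open>y [^] (2 * k)\<close>. Cancelling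
        \<open>y [^] (2 * k)\<close> modulo \<open>P\<close> shows that \<open>s\<close> is
        congruent to a multiple of \<open>y\<close> modulo \<open>P\<close>, and this forces
        \<open>s \<in> Q\<close>.\<close>
      define d where "d = 2 * n - 2 * k - 1"
      have "2 * n = Suc d + 2 * k" using less by (auto simp: d_def)
      then have z: "?z = (y [^] d \<otimes> y) \<otimes> y [^] (2 * k)"
        using yc by (metis nat_pow_Suc nat_pow_mult)
      have pc: "p \<in> carrier R" using p ideal_closed(1)[OF Pi] by blast
      define u where "u = y [^] (2 * k)"
      define v where "v = y [^] d"
      have uv: "u \<in> carrier R" "v \<in> carrier R" "s \<in> carrier R" using yc s by (auto simp: u_def v_def)
      have eq: "s \<otimes> u = p \<oplus> r \<otimes> ((v \<otimes> y) \<otimes> u)" using pr(3) z by (simp add: u_def v_def)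
      have "u \<otimes> (s \<ominus> r \<otimes> (v \<otimes> y)) = s \<otimes> u \<ominus> r \<otimes> ((v \<otimes> y) \<otimes> u)"
        using uv yc pr(2) by algebra
      also have "\<dots> = p" unfolding eq using uv yc pr(2) pc by algebra
      finally have "u \<otimes> (s \<ominus> r \<otimes> (v \<otimes> y)) \<in> P" using p by simp
      then have "s \<ominus> r \<otimes> (v \<otimes> y) \<in> P"
        using primeideal.I_prime[OF P, of u "s \<ominus> r \<otimes> (v \<otimes> y)"] yP[of "2 * k"] uv yc pr(2)
        by (auto simp: u_def)
      then have "s \<ominus> r \<otimes> (v \<otimes> y) \<in> Q" using PQ by blast
      moreover have "r \<otimes> (v \<otimes> y) \<in> Q" using ideal_closed(5)[OF Qi] y uv pr(2) by simp
      ultimately have "(s \<ominus> r \<otimes> (v \<otimes> y)) \<oplus> r \<otimes> (v \<otimes> y) \<in> Q"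
        using ideal_closed(3)[OF Qi] by blast
      moreover have "(s \<ominus> r \<otimes> (v \<otimes> y)) \<oplus> r \<otimes> (v \<otimes> y) = s" using uv yc pr(2) by algebra
      ultimately show False using s(1) by simp
    qed
    have "w \<in> I" using sub(1) cgenideal_self[OF wc] by blast
    also have "I \<subseteq> ideal_power R Q k"
      unfolding Js(3) k_def by (rule ideal_prod_list_subset_power[OF Q Js(2)])
    also have "\<dots> \<subseteq> ideal_power R Q n" by (rule ideal_power_antimono[OF Qi \<open>n \<le> k\<close>])
    finally show "w \<in> ideal_power R Q n" .
  qed
qed

text \<open>Locality enters through \<open>princ\<close>, which a local domain satisfies because the
  factors of a principal ideal are principal. The prime \<open>P0\<close> serves to find an element
  \<open>y\<close> outside \<open>P\<close> and a prime \<open>Q\<close> minimal over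
  \<open>P + (y)\<close>.\<close>

lemma (in domain) TA_factorization_imp_zero_primeideal:
  assumes fact: "\<And>I. proper_ideal I R \<Longrightarrow> has_TA_factorization R I"
    and princ: "\<And>Q y. primeideal Q R \<Longrightarrow> y \<in> Q \<Longrightarrow> y \<noteq> \<zero> \<Longrightarrow>
      \<exists>t\<in>Q. t \<noteq> \<zero> \<and> TA_ideal (PIdl t) R \<and> y \<in> PIdl t"
    and P: "primeideal P R" and P0: "primeideal P0 R" and PP0: "P \<subseteq> P0" "P \<noteq> P0"
  shows "P = {\<zero>}"
proof (rule ccontr)
  assume "P \<noteq> {\<zero>}"
  note Pi = primeideal_closed(1)[OF P]
  note Pc = ideal_closed(1)[OF Pi]
  obtain x where x: "x \<in> P" "x \<noteq> \<zero>" using ideal_closed(2)[OF Pi] \<open>P \<noteq> {\<zero>}\<close> by blast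
  obtain y where y: "y \<in> P0" "y \<notin> P" using PP0 by blast
  have yc: "y \<in> carrier R" using ideal_closed(1)[OF primeideal_closed(1)[OF P0]] y by blast
  have sub0: "P <+>\<^bsub>R\<^esub> PIdl y \<subseteq> P0"
    using primeideal_closed(1)[OF P0] y PP0 by (intro set_add_subset_ideal cgenideal_minimal)
  obtain Q where Q: "primeideal Q R" "P <+>\<^bsub>R\<^esub> PIdl y \<subseteq> Q" and
    minQ: "\<And>P'. primeideal P' R \<Longrightarrow> P <+>\<^bsub>R\<^esub> PIdl y \<subseteq> P' \<Longrightarrow> P' \<subseteq> Q \<Longrightarrow> P' = Q"
    using exists_minimal_primeideal[OF P0 sub0] by metis
  note Qi = primeideal_closed(1)[OF Q(1)]
  have PQ: "P \<subseteq> Q" and yQ: "y \<in> Q"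
    using ideal_subset_set_add[OF Pi cgenideal_ideal[OF yc]] Q(2) cgenideal_self[OF yc] by auto
  then have neq: "P \<noteq> Q" using y by blast
  have "y \<noteq> \<zero>" using y ideal_closed(2)[OF Pi] by blast
  then obtain t where t: "t \<in> Q" "TA_ideal (PIdl t) R" "y \<in> PIdl t"
    using princ[OF Q(1) yQ] by blast
  have tc: "t \<in> carrier R" using t ideal_closed(1)[OF Qi] by blast
  note ti = cgenideal_ideal[OF tc]
  have tP: "t \<notin> P" using t(3) y(2) cgenideal_minimal[OF Pi] by blast
  \<comment> \<open>As \<open>y\<close> is a multiple of \<open>t\<close>, a prime containing
    \<open>P\<close> and \<open>t\<close> contains \<open>y\<close>; so the minimality of
    \<open>Q\<close> over \<open>P + (y)\<close> passes to \<open>P + (t)\<close>.\<close>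
  have minQt: "P' = Q" if "primeideal P' R" "P \<subseteq> P'" "t \<in> P'" "P' \<subseteq> Q" for P'
  proof (rule minQ[OF that(1) _ that(4)])
    have i: "ideal P' R" using primeideal_closed(1)[OF that(1)] .
    then have "y \<in> P'" using cgenideal_minimal[OF i that(3)] t(3) by blast
    then show "P <+>\<^bsub>R\<^esub> PIdl y \<subseteq> P'" using that(2)
      by (intro set_add_subset_ideal[OF i] cgenideal_minimal[OF i])
  qed
  have powers: "A \<subseteq> ideal_power R B n"
    if "primeideal A R" "primeideal B R" "A \<subseteq> B" "A \<noteq> B" for A B n
    using that by (intro primeideal_subset_ideal_power fact)
  show False
  proof (cases "\<forall>P'. primeideal P' R \<longrightarrow> PIdl t \<subseteq> P' \<longrightarrow> P' \<subseteq> Q \<longrightarrow> P' = Q")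
    case True
    have loc: "loc_subset R Q (Q \<cdot> Q) (PIdl t)"
      using True by (intro TA_ideal_loc_subset[OF Q(1) t(2)]) blast
    note QQi = ideal_prod_is_ideal[OF Qi Qi]
    have loc2: "loc_subset R Q ((Q \<cdot> Q) \<cdot> (Q \<cdot> Q)) ((PIdl t) \<cdot> (PIdl t))"
      by (intro loc_subset_prod_mono[OF Q(1)] QQi ti loc)
    have "ideal_power R Q (Suc (Suc 0)) = Q \<cdot> Q"
      by (simp add: ideal_power_Suc ideal_power_0 ideal_prod_one Qi)
    \<comment> \<open>Locally \<open>Q^2\<close> lies in \<open>(t)\<close>, so the fourth power of
      \<open>Q\<close> is what reaches \<open>(t)^2\<close>.\<close>
    then have p4: "ideal_power R Q (2 + 2) = (Q \<cdot> Q) \<cdot> (Q \<cdot> Q)"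
      using ideal_power_add[OF Qi, of 2 2] by (simp add: numeral_2_eq_2)
    obtain w where w: "w \<in> P" "w \<noteq> \<zero>" "TA_ideal (PIdl w) R" using princ[OF P x] by blast
    have wc: "w \<in> carrier R" using Pc w by blast
    have "w \<in> (Q \<cdot> Q) \<cdot> (Q \<cdot> Q)" using powers[OF P Q(1) PQ neq, of "2 + 2"] w p4 by auto
    then obtain s where s: "s \<in> carrier R - Q" "s \<otimes> w \<in> (PIdl t) \<cdot> (PIdl t)"
      using loc2 unfolding loc_subset_def by blast
    have "(PIdl t) \<cdot> (PIdl t) \<subseteq> PIdl (t \<otimes> t)"
    proof (rule ideal_prod_subset)
      fix a b assume "a \<in> PIdl t" "b \<in> PIdl t"
      then obtain r q where "r \<in> carrier R" "q \<in> carrier R" "a = r \<otimes> t" "b = q \<otimes> t"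
        by (auto simp: cgenideal_def)
      then show "a \<otimes> b \<in> PIdl (t \<otimes> t)"
        using tc PIdl_memI[of "r \<otimes> q" "t \<otimes> t"] by (simp add: m_ac)
    qed (simp add: tc cgenideal_ideal)
    then obtain z where z: "z \<in> carrier R" "s \<otimes> w = z \<otimes> (t \<otimes> t)"
      using s(2) by (auto simp: cgenideal_def)
    have wi: "PIdl w \<subseteq> P" using cgenideal_minimal[OF Pi w(1)] .
    have ttP: "t \<otimes> t \<notin> P" using primeideal_closed(3)[OF P, of t t] tc tP by auto
    \<comment> \<open>Here \<open>t \<otimes> t \<otimes> z\<close> equals
      \<open>s \<otimes> w\<close>. Since \<open>t \<otimes> t\<close> is outside the prime
      \<open>P\<close>, the 2-absorbing ideal \<open>(w)\<close> must contain
      \<open>t \<otimes> z = e \<otimes> w\<close>; cancelling \<open>w\<close> in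
      \<open>s \<otimes> w = t \<otimes> e \<otimes> w\<close> gives
      \<open>s = t \<otimes> e \<in> Q\<close>.\<close>
    have "t \<otimes> t \<otimes> z \<in> PIdl w"
      using PIdl_memI[of s w] z s tc by (simp add: m_ac)
    then have "t \<otimes> t \<in> PIdl w \<or> t \<otimes> z \<in> PIdl w"
      using w(3) tc z(1) unfolding TA_ideal_def by blast
    then obtain e where e: "e \<in> carrier R" "t \<otimes> z = e \<otimes> w"
      using wi ttP by (auto simp: cgenideal_def)
    have "s \<otimes> w = t \<otimes> (t \<otimes> z)" using z tc by (simp add: m_ac)
    also have "\<dots> = (t \<otimes> e) \<otimes> w" using e tc wc by (simp add: m_ac)
    finally have "s = t \<otimes> e" using m_rcancel[OF w(2) wc] s e tc by auto
    then show False using s(1) ideal_closed(6)[OF Qi e(1) t(1)] by simp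
  next
    case False
    then obtain P' where P': "primeideal P' R" "PIdl t \<subseteq> P'" "P' \<subseteq> Q" "P' \<noteq> Q" by blast
    define I where "I = P <+>\<^bsub>R\<^esub> PIdl t"
    have Ii: "ideal I R" unfolding I_def by (intro add_ideals Pi ti)
    have tI: "t \<in> I" and PI: "P \<subseteq> I"
      using ideal_subset_set_add[OF Pi ti] cgenideal_self[OF tc] by (auto simp: I_def)
    have IQ: "I \<subseteq> Q" unfolding I_def
      using PQ P' by (intro set_add_subset_ideal[OF Qi]) auto
    have "has_TA_factorization R I" using fact proper_ideal_subset_primeideal Ii IQ Q(1) by blast
    then obtain Js where Js: "\<And>J. J \<in> set Js \<Longrightarrow> TA_ideal J R" "\<forall>J\<in>set Js. ideal J R"
      "I = ideal_prod_list R Js" by (rule TA_factorizationE) blast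
    define n where "n = 2 * length (filter (\<lambda>J. J \<subseteq> Q) Js)"
    have loc: "loc_subset R Q (ideal_power R Q n) I"
      unfolding Js(3) n_def
    proof (rule loc_subset_ideal_prod_list[OF Q(1) Js(2)])
      fix J assume J: "J \<in> set Js" "J \<subseteq> Q"
      then have IJ: "I \<subseteq> J" unfolding Js(3) using ideal_prod_list_subset_mem[OF Js(2)] by blast
      show "loc_subset R Q (Q \<cdot> Q) J"
      proof (rule TA_ideal_loc_subset[OF Q(1) Js(1)[OF J(1)]])
        fix P'' assume "primeideal P'' R" "J \<subseteq> P''" "P'' \<subseteq> Q"
        then show "P'' = Q" using minQt[of P''] IJ tI PI by blast
      qed
    qed
    note Pn = ideal_power_ideal[OF Qi, of n]
    \<comment> \<open>The exponent is doubled to reach \<open>I \<cdot> I\<close> instead of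
      \<open>I\<close>: squaring \<open>P + (t)\<close> leaves \<open>t\<close> only in the form
      \<open>t \<otimes> t\<close> modulo \<open>P\<close>.\<close>
    have loc2: "loc_subset R Q (ideal_power R Q (n + n)) (I \<cdot> I)"
      unfolding ideal_power_add[OF Qi] by (intro loc_subset_prod_mono[OF Q(1)] Pn Ii loc)
    have "t \<in> P'" using P'(2) cgenideal_self[OF tc] by blast
    then have "t \<in> ideal_power R Q (n + n)" using powers[OF P'(1) Q(1) P'(3,4)] by blast
    then obtain s where s: "s \<in> carrier R - Q" "s \<otimes> t \<in> I \<cdot> I"
      using loc2 unfolding loc_subset_def by blast
    have "I \<cdot> I \<subseteq> P <+>\<^bsub>R\<^esub> PIdl (t \<otimes> t)"
    proof (rule ideal_prod_subset)
      show "ideal (P <+>\<^bsub>R\<^esub> PIdl (t \<otimes> t)) R"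
        by (intro add_ideals Pi cgenideal_ideal) (simp add: tc)
      fix a b assume "a \<in> I" "b \<in> I"
      then obtain p q r u where *: "p \<in> P" "q \<in> P" "r \<in> carrier R" "u \<in> carrier R"
        "a = p \<oplus> r \<otimes> t" "b = q \<oplus> u \<otimes> t" by (auto simp: I_def mem_set_add_PIdl_iff)
      then have c: "p \<in> carrier R" "q \<in> carrier R" using Pc by auto
      have "a \<otimes> b = ((q \<oplus> u \<otimes> t) \<otimes> p \<oplus> (r \<otimes> t) \<otimes> q) \<oplus> (r \<otimes> u) \<otimes> (t \<otimes> t)"
        unfolding *(5,6) using c * tc by algebra
      moreover have "(q \<oplus> u \<otimes> t) \<otimes> p \<oplus> (r \<otimes> t) \<otimes> q \<in> P"
        using * c tc ideal_closed[OF Pi] by simp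
      ultimately show "a \<otimes> b \<in> P <+>\<^bsub>R\<^esub> PIdl (t \<otimes> t)"
        using * unfolding mem_set_add_PIdl_iff by blast
    qed
    then have "s \<otimes> t \<in> P <+>\<^bsub>R\<^esub> PIdl (t \<otimes> t)" using s(2) by blast
    then obtain p r where pr: "p \<in> P" "r \<in> carrier R" "s \<otimes> t = p \<oplus> r \<otimes> (t \<otimes> t)"
      unfolding mem_set_add_PIdl_iff by blast
    have pc: "p \<in> carrier R" using pr Pc by blast
    have sc: "s \<in> carrier R" using s by blast
    \<comment> \<open>Since \<open>t\<close> is outside \<open>P\<close>, it can be cancelled modulo
      \<open>P\<close>. Then \<open>s\<close> is congruent to \<open>r \<otimes> t\<close> modulo
      \<open>P\<close>, hence in \<open>Q\<close>.\<close>
    have "t \<otimes> (s \<ominus> r \<otimes> t) = s \<otimes> t \<ominus> r \<otimes> (t \<otimes> t)" using sc tc pr(2) by algebra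
    also have "\<dots> = p" unfolding pr(3) using pc tc pr(2) by algebra
    finally have "s \<ominus> r \<otimes> t \<in> P"
      using primeideal.I_prime[OF P tc, of "s \<ominus> r \<otimes> t"] tP pr sc tc by auto
    then have "(s \<ominus> r \<otimes> t) \<oplus> r \<otimes> t \<in> Q"
      using PQ ideal_closed(3,5)[OF Qi] t(1) pr(2) by blast
    moreover have "(s \<ominus> r \<otimes> t) \<oplus> r \<otimes> t = s" using sc tc pr(2) by algebra
    ultimately show False using s(1) by simp
  qed
qed

section \<open>Atoms and local domains\<close>

text \<open>The empty list is allowed, so one counts as a product of atoms. This gives closure under
  multiplication and suits inductions over lists of factors.\<close>

definition atom_product :: "('a, 'b) ring_scheme \<Rightarrow> 'a \<Rightarrow> bool" where
  "atom_product R x \<longleftrightarrow> (\<exists>as. (\<forall>a\<in>set as. atom R a) \<and> x = foldr (\<otimes>\<^bsub>R\<^esub>) as \<one>\<^bsub>R\<^esub>)"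

lemma atomic_iff_atom_product:
  "atomic R \<longleftrightarrow> (\<forall>x\<in>carrier R. x \<noteq> \<zero>\<^bsub>R\<^esub> \<longrightarrow> x \<notin> Units R \<longrightarrow> atom_product R x)"
  unfolding atomic_def atom_product_def ..

context domain
begin

lemma foldr_mult_closed: "set xs \<subseteq> carrier R \<Longrightarrow> foldr (\<otimes>) xs \<one> \<in> carrier R"
  by (induction xs) auto

lemma foldr_mult_append:
  "set xs \<subseteq> carrier R \<Longrightarrow> set ys \<subseteq> carrier R \<Longrightarrow>
    foldr (\<otimes>) (xs @ ys) \<one> = foldr (\<otimes>) xs \<one> \<otimes> foldr (\<otimes>) ys \<one>"
proof (induction xs)
  case Nil
  then show ?case using foldr_mult_closed[of ys] by simp
next
  case (Cons x xs)
  then show ?case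
    using foldr_mult_closed[of ys] foldr_mult_closed[of xs] by (simp add: m_assoc)
qed

lemma foldr_mult_nonzero:
  "set xs \<subseteq> carrier R \<Longrightarrow> foldr (\<otimes>) xs \<one> \<noteq> \<zero> \<Longrightarrow> t \<in> set xs \<Longrightarrow> t \<noteq> \<zero>"
proof (induction xs)
  case (Cons a xs)
  then have "foldr (\<otimes>) xs \<one> \<noteq> \<zero>" "a \<noteq> \<zero>"
    using foldr_mult_closed[of xs] by auto
  with Cons show ?case by auto
qed simp

lemma atom_product_one: "atom_product R \<one>"
  unfolding atom_product_def by (intro exI[of _ "[]"]) simp

lemma atom_product_atom:
  assumes "atom R a"
  shows "atom_product R a"
proof -
  have "a = foldr (\<otimes>) [a] \<one>" using assms by (simp add: atom_def)
  then show ?thesis using assms unfolding atom_product_def by (intro exI[of _ "[a]"]) auto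
qed

lemma atom_product_mult:
  assumes "atom_product R x" "atom_product R y"
  shows "atom_product R (x \<otimes> y)"
proof -
  obtain as bs where *: "\<forall>a\<in>set as. atom R a" "x = foldr (\<otimes>) as \<one>"
    "\<forall>a\<in>set bs. atom R a" "y = foldr (\<otimes>) bs \<one>"
    using assms unfolding atom_product_def by blast
  then have "set as \<subseteq> carrier R" "set bs \<subseteq> carrier R" by (auto simp: atom_def)
  then have "x \<otimes> y = foldr (\<otimes>) (as @ bs) \<one>" using * foldr_mult_append by simp
  then show ?thesis using * unfolding atom_product_def by (intro exI[of _ "as @ bs"]) auto
qed

lemma inv_mult_Units_mult: "u \<in> Units R \<Longrightarrow> x \<in> carrier R \<Longrightarrow> inv u \<otimes> (u \<otimes> x) = x"
  by (metis Units_closed Units_inv_closed Units_l_inv l_one m_assoc)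

lemma Units_mult_cancel_iff:
  assumes "u \<in> Units R" "x \<in> carrier R"
  shows "u \<otimes> x \<in> Units R \<longleftrightarrow> x \<in> Units R"
proof
  assume "u \<otimes> x \<in> Units R"
  then have "inv u \<otimes> (u \<otimes> x) \<in> Units R" using assms by blast
  then show "x \<in> Units R" using assms by (simp add: inv_mult_Units_mult)
qed (use assms in blast)

lemma atom_Units_mult:
  assumes "atom R a" "u \<in> Units R"
  shows "atom R (u \<otimes> a)"
proof -
  have a: "a \<in> carrier R" "a \<noteq> \<zero>" "a \<notin> Units R"
    and irr: "\<And>b c. b \<in> carrier R - Units R \<Longrightarrow> c \<in> carrier R - Units R \<Longrightarrow> a \<noteq> b \<otimes> c"
    using assms(1) by (auto simp: atom_def)
  have u: "u \<in> carrier R" "inv u \<in> carrier R" "inv u \<in> Units R" using assms(2) by auto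
  have "u \<noteq> \<zero>" using assms(2) unfolding Units_def using zero_not_one by fastforce
  have "u \<otimes> a \<noteq> b \<otimes> c" if bc: "b \<in> carrier R - Units R" "c \<in> carrier R - Units R" for b c
  proof
    assume eq: "u \<otimes> a = b \<otimes> c"
    have "a = inv u \<otimes> (u \<otimes> a)" using a assms(2) by (simp add: inv_mult_Units_mult)
    also have "\<dots> = (inv u \<otimes> b) \<otimes> c" unfolding eq using u bc by (simp add: m_assoc)
    finally have "a = (inv u \<otimes> b) \<otimes> c" .
    moreover have "inv u \<otimes> b \<in> carrier R - Units R"
      using bc u Units_mult_cancel_iff[OF u(3)] by auto
    ultimately show False using irr bc by blast
  qed
  then show ?thesis
    using a u \<open>u \<noteq> \<zero>\<close> Units_mult_cancel_iff[OF assms(2) a(1)] by (auto simp: atom_def integral_iff)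
qed

text \<open>The unit is absorbed by the first atom, which exists because a nonunit is not the empty
  product.\<close>

lemma atom_product_Units_mult:
  assumes "atom_product R x" "u \<in> Units R" "x \<notin> Units R"
  shows "atom_product R (u \<otimes> x)"
proof -
  obtain as where as: "\<forall>a\<in>set as. atom R a" "x = foldr (\<otimes>) as \<one>"
    using assms(1) unfolding atom_product_def by blast
  then obtain b bs where b: "as = b # bs" using assms(3) by (cases as) auto
  then have "atom R b" and bs: "atom_product R (foldr (\<otimes>) bs \<one>)" "set bs \<subseteq> carrier R"
    using as unfolding atom_product_def by (auto simp: atom_def)
  then have "atom_product R (u \<otimes> b)" using atom_product_atom atom_Units_mult assms(2) by blast
  then have "atom_product R ((u \<otimes> b) \<otimes> foldr (\<otimes>) bs \<one>)" using bs(1) by (rule atom_product_mult)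
  moreover have "u \<otimes> x = (u \<otimes> b) \<otimes> foldr (\<otimes>) bs \<one>"
    using \<open>atom R b\<close> bs assms(2) foldr_mult_closed[of bs] as(2) b by (simp add: atom_def m_assoc Units_closed)
  ultimately show ?thesis by simp
qed

text \<open>A nonzero nonunit that is no product of atoms splits into two nonunits, one of which is
  again no product of atoms. By cancellation its principal ideal is strictly larger, and dependent
  choice yields an infinite strict chain.\<close>

lemma ACCP_imp_atomic:
  assumes "ACCP R"
  shows "atomic R"
proof (rule ccontr)
  assume "\<not> atomic R"
  define B where "B = {x \<in> carrier R. x \<noteq> \<zero> \<and> x \<notin> Units R \<and> \<not> atom_product R x}"
  obtain x0 where x0: "x0 \<in> B" using \<open>\<not> atomic R\<close> by (auto simp: atomic_iff_atom_product B_def)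
  have half: "PIdl x \<subset> PIdl b" if "x = b \<otimes> c" "b \<in> carrier R" "c \<in> carrier R - Units R" "x \<noteq> \<zero>" for x b c
  proof -
    have xb: "x \<in> PIdl b" using that PIdl_memI[of c b] by (simp add: m_comm)
    have "b \<notin> PIdl x"
    proof
      assume "b \<in> PIdl x"
      then obtain r where r: "r \<in> carrier R" "b = r \<otimes> x" by (auto simp: cgenideal_def)
      have "b \<noteq> \<zero>" using that by auto
      have "b \<otimes> (r \<otimes> c) = b \<otimes> \<one>"
        using r that by (metis DiffD1 m_assoc m_closed m_comm r_one)
      then have "r \<otimes> c = \<one>"
        using m_lcancel[OF \<open>b \<noteq> \<zero>\<close>, of "r \<otimes> c" \<one>] that r(1) by blast
      then show False using that r m_comm[of r c] unfolding Units_def by auto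
    qed
    then show ?thesis
      using cgenideal_self[OF that(2)] cgenideal_minimal[OF cgenideal_ideal[OF that(2)] xb] by blast
  qed
  have step: "\<exists>y. y \<in> B \<and> PIdl x \<subset> PIdl y" if x: "x \<in> B" for x
  proof -
    have "\<not> atom R x" using x atom_product_atom by (auto simp: B_def)
    then obtain b c where bc: "b \<in> carrier R - Units R" "c \<in> carrier R - Units R" "x = b \<otimes> c"
      using x by (auto simp: atom_def B_def)
    have nz: "b \<noteq> \<zero>" "c \<noteq> \<zero>" "x \<noteq> \<zero>" using x bc by (auto simp: B_def)
    have "b \<in> B \<or> c \<in> B"
      using x bc nz atom_product_mult[of b c] by (auto simp: B_def)
    moreover have "PIdl x \<subset> PIdl b" "PIdl x \<subset> PIdl c"
      using half[of x b c] half[of x c b] bc nz m_comm[of b c] by auto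
    ultimately show ?thesis by blast
  qed
  obtain f :: "nat \<Rightarrow> 'a" where f: "\<And>n. f n \<in> B" "\<And>n. PIdl (f n) \<subset> PIdl (f (Suc n))"
    using dependent_nat_choice[of "\<lambda>_ y. y \<in> B" "\<lambda>_ y z. PIdl y \<subset> PIdl z"] x0 step by metis
  then have "\<exists>N. \<forall>n\<ge>N. PIdl (f n) = PIdl (f N)"
    using assms unfolding ACCP_def B_def by blast
  then obtain N where "\<forall>n\<ge>N. PIdl (f n) = PIdl (f N)" ..
  then have "PIdl (f (Suc N)) = PIdl (f N)" by (meson le_SucI order_refl)
  then show False using f(2)[of N] by blast
qed

end

section \<open>Local domains that are not fields\<close>

locale local_nonfield_domain = domain R for R (structure) +
  fixes M
  assumes local: "local_ring R M" and not_field: "\<not> field R"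
begin

lemma M_maximal: "maximalideal M R"
  using local by (simp add: local_ring_def)

lemma M_ideal: "ideal M R"
  using M_maximal by (simp add: maximalideal_def)

lemma M_prime: "primeideal M R"
  using maximalideal_prime[OF M_maximal] .

lemma one_notin_M: "\<one> \<notin> M"
  using primeideal_closed(2)[OF M_prime] .

lemmas M_closed = ideal_closed[OF M_ideal]

lemma M_nonzero: "M \<noteq> {\<zero>}"
  using zeromaximalideal_fieldI M_maximal not_field by blast

text \<open>A nonunit lies in an ideal maximal among those avoiding \<open>\<one>\<close>; such an
  ideal is maximal and therefore equals \<open>M\<close>.\<close>

lemma mem_M_iff: "x \<in> M \<longleftrightarrow> x \<in> carrier R \<and> x \<notin> Units R"
proof
  assume x: "x \<in> M"
  then have xc: "x \<in> carrier R" using M_closed by blast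
  have "x \<notin> Units R"
  proof
    assume "x \<in> Units R"
    then have "inv x \<otimes> x = \<one>" "inv x \<in> carrier R" by auto
    then show False using M_closed(5)[of "inv x" x] x one_notin_M by simp
  qed
  with xc show "x \<in> carrier R \<and> x \<notin> Units R" by blast
next
  assume x: "x \<in> carrier R \<and> x \<notin> Units R"
  have "\<one> \<notin> PIdl x"
    using x m_comm unfolding cgenideal_def Units_def by force
  then have "PIdl x \<inter> {\<one>} = {}" by blast
  then obtain P where P: "ideal P R" "PIdl x \<subseteq> P" "P \<inter> {\<one>} = {}"
    "\<And>J. ideal J R \<Longrightarrow> P \<subseteq> J \<Longrightarrow> J \<inter> {\<one>} = {} \<Longrightarrow> J = P"
    using exists_ideal_maximal_disjoint[OF cgenideal_ideal] x by metis
  have "maximalideal P R"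
  proof (rule maximalidealI[OF P(1)])
    show "carrier R \<noteq> P" using P(3) one_closed by blast
    fix J assume J: "ideal J R" "P \<subseteq> J" "J \<subseteq> carrier R"
    then show "J = P \<or> J = carrier R"
      using P(4) ideal.one_imp_carrier[OF J(1)] by blast
  qed
  then have "P = M" using local by (simp add: local_ring_def)
  then show "x \<in> M" using P(2) cgenideal_self x by blast
qed

lemma proper_ideal_iff: "proper_ideal I R \<longleftrightarrow> ideal I R \<and> I \<subseteq> M"
proof
  assume I: "proper_ideal I R"
  then have i: "ideal I R" "\<one> \<notin> I"
    using ideal.one_imp_carrier by (auto simp: proper_ideal_def)
  have "I \<subseteq> M"
  proof
    fix x assume x: "x \<in> I"
    then have xc: "x \<in> carrier R" using ideal_closed(1)[OF i(1)] by blast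
    show "x \<in> M"
    proof (rule ccontr)
      assume "x \<notin> M"
      then have "x \<in> Units R" using xc mem_M_iff by blast
      then show False using ideal_closed(5)[OF i(1), of "inv x" x] x i(2) by simp
    qed
  qed
  with i show "ideal I R \<and> I \<subseteq> M" by blast
qed (use one_notin_M one_closed in \<open>auto simp: proper_ideal_def\<close>)

lemma primeideal_subset_M: "primeideal P R \<Longrightarrow> P \<subseteq> M"
  using primeideal_closed[of P] proper_ideal_iff[of P] one_closed by (auto simp: proper_ideal_def)

lemma PIdl_proper_iff: "x \<in> carrier R \<Longrightarrow> proper_ideal (PIdl x) R \<longleftrightarrow> x \<in> M"
  using proper_ideal_iff cgenideal_ideal cgenideal_minimal[OF M_ideal] cgenideal_self by blast

text \<open>The chain \<open>{\<zero>} \<subset> M\<close> is always present, so dimension one means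
  that no prime lies strictly between; the middle term of a chain of three primes would.\<close>

lemma krull_dim_eq_1_iff:
  "krull_dim R = 1 \<longleftrightarrow> (\<forall>P. primeideal P R \<longrightarrow> P = {\<zero>} \<or> P = M)"
proof -
  define L where "L = {enat n | n. \<exists>P. (\<forall>i\<le>n. primeideal (P i) R) \<and> (\<forall>i<n. P i \<subset> P (Suc i))}"
  have dim: "krull_dim R = Sup L" by (simp add: krull_dim_def L_def)
  have M0: "{\<zero>} \<subset> M" using M_nonzero M_closed(2) by blast
  have one: "1 \<in> L"
  proof -
    define C where "C = (\<lambda>i::nat. if i = 0 then {\<zero>} else M)"
    have "\<forall>i\<le>1. primeideal (C i) R" "\<forall>i<1. C i \<subset> C (Suc i)"
      using M0 zeroprimeideal M_prime by (simp_all add: C_def)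
    then show ?thesis unfolding L_def one_enat_def by blast
  qed
  show ?thesis
  proof
    assume 1: "krull_dim R = 1"
    show "\<forall>P. primeideal P R \<longrightarrow> P = {\<zero>} \<or> P = M"
    proof (intro allI impI, rule ccontr)
      fix P assume P: "primeideal P R" "\<not> (P = {\<zero>} \<or> P = M)"
      have i: "P \<subset> M" "{\<zero>} \<subset> P"
        using P primeideal_subset_M ideal_closed(2)[OF primeideal_closed(1)[OF P(1)]] by auto
      define C where "C = (\<lambda>i::nat. if i = 0 then {\<zero>} else if i = 1 then P else M)"
      have "\<forall>i\<le>2. primeideal (C i) R" "\<forall>i<2. C i \<subset> C (Suc i)"
        using i P(1) zeroprimeideal M_prime by (auto simp: C_def less_2_cases_iff)
      then have "enat 2 \<in> L" unfolding L_def by blast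
      then have "enat 2 \<le> 1" using 1 dim Sup_upper by metis
      then show False by (simp add: one_enat_def)
    qed
  next
    assume *: "\<forall>P. primeideal P R \<longrightarrow> P = {\<zero>} \<or> P = M"
    have "e \<le> 1" if e: "e \<in> L" for e
    proof -
      obtain n P where n: "e = enat n" "\<forall>i\<le>n. primeideal (P i) R" "\<forall>i<n. P i \<subset> P (Suc i)"
        using e unfolding L_def by blast
      have "n \<le> 1"
      proof (rule ccontr)
        assume "\<not> n \<le> 1"
        then have C: "P 0 \<subset> P (Suc 0)" "P (Suc 0) \<subset> P (Suc (Suc 0))"
          and prime: "primeideal (P 0) R" "primeideal (P (Suc 0)) R" "primeideal (P (Suc (Suc 0))) R"
          using n by auto
        have "P (Suc 0) \<noteq> M" using C(2) primeideal_subset_M[OF prime(3)] by blast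
        then have "P (Suc 0) = {\<zero>}" using * prime(2) by blast
        then show False using C(1) ideal_closed(2)[OF primeideal_closed(1)[OF prime(1)]] by auto
      qed
      then show ?thesis using n by (simp add: one_enat_def)
    qed
    then have "Sup L = 1" using one by (intro antisym Sup_least Sup_upper)
    then show "krull_dim R = 1" using dim by simp
  qed
qed

text \<open>Invertible ideals of a local domain are principal.\<close>

lemma ideal_prod_eq_PIdl:
  assumes J: "ideal J R" and I: "ideal I R" and x: "x \<in> carrier R" "x \<noteq> \<zero>"
    and JI: "J \<cdot> I = PIdl x"
  obtains a b where "a \<in> carrier R" "b \<in> carrier R" "J = PIdl a" "I = PIdl b" "x = a \<otimes> b"
proof -
  have sub: "\<exists>d\<in>carrier R. j \<otimes> i = d \<otimes> x" if "j \<in> J" "i \<in> I" for j i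
    using ideal_prod.prod[OF that, of R] unfolding JI by (auto simp: cgenideal_def)
  \<comment> \<open>If no product \<open>j \<otimes> i\<close> were a unit times \<open>x\<close>,
    all of them, and with them \<open>(x)\<close>, would lie in \<open>xM\<close>. Then
    \<open>x = m \<otimes> x\<close> with \<open>m \<in> M\<close>, so that
    \<open>\<one> \<in> M\<close>.\<close>
  have "\<exists>j\<in>J. \<exists>i\<in>I. \<exists>d\<in>Units R. j \<otimes> i = d \<otimes> x"
  proof (rule ccontr)
    assume no: "\<not> ?thesis"
    have idl: "ideal ((\<lambda>m. m \<otimes> x) ` M) R"
    proof (rule idealI_elementwise)
      show "(\<lambda>m. m \<otimes> x) ` M \<subseteq> carrier R" using M_closed(1) x by auto
      have "\<zero> = \<zero> \<otimes> x" using x by simp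
      then show "\<zero> \<in> (\<lambda>m. m \<otimes> x) ` M" using M_closed(2) by blast
    next
      fix y z assume "y \<in> (\<lambda>m. m \<otimes> x) ` M" "z \<in> (\<lambda>m. m \<otimes> x) ` M"
      then obtain m n where mn: "m \<in> M" "n \<in> M" "y = m \<otimes> x" "z = n \<otimes> x" by blast
      then have "y \<oplus> z = (m \<oplus> n) \<otimes> x" using M_closed(1) x by (simp add: l_distr)
      then show "y \<oplus> z \<in> (\<lambda>m. m \<otimes> x) ` M" using M_closed(3) mn by blast
    next
      fix r y assume "r \<in> carrier R" "y \<in> (\<lambda>m. m \<otimes> x) ` M"
      then obtain m where m: "m \<in> M" "y = m \<otimes> x" "r \<in> carrier R" by blast
      then have "r \<otimes> y = (r \<otimes> m) \<otimes> x" using M_closed(1) x by (simp add: m_assoc)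
      then show "r \<otimes> y \<in> (\<lambda>m. m \<otimes> x) ` M" using M_closed(5) m by blast
    qed
    have "J \<cdot> I \<subseteq> (\<lambda>m. m \<otimes> x) ` M"
    proof (rule ideal_prod_subset[OF idl])
      fix j i assume ji: "j \<in> J" "i \<in> I"
      then obtain d where "d \<in> carrier R" "j \<otimes> i = d \<otimes> x" using sub by blast
      then show "j \<otimes> i \<in> (\<lambda>m. m \<otimes> x) ` M" using no ji mem_M_iff by blast
    qed
    then obtain m where m: "m \<in> M" "x = m \<otimes> x" using JI cgenideal_self[OF x(1)] by blast
    then have "\<one> \<otimes> x = m \<otimes> x" using x by simp
    then have "\<one> = m" using m_rcancel[OF x(2,1) one_closed M_closed(1)[OF m(1)]] by blast
    then show False using m one_notin_M by blast
  qed
  then obtain j i d where *: "j \<in> J" "i \<in> I" "d \<in> Units R" "j \<otimes> i = d \<otimes> x" by blast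
  have c: "j \<in> carrier R" "i \<in> carrier R" "inv d \<in> carrier R" "d \<in> carrier R"
    using * ideal_closed(1)[OF J] ideal_closed(1)[OF I] by auto
  \<comment> \<open>Scaling \<open>j\<close> by a unit makes \<open>a \<otimes> i = x\<close> exact.
    For \<open>y \<in> J\<close> the product \<open>y \<otimes> i\<close> is then a multiple of
    \<open>a \<otimes> i\<close>, and cancelling \<open>i\<close> gives \<open>y \<in> (a)\<close>;
    the same works for \<open>I\<close>.\<close>
  define a where "a = inv d \<otimes> j"
  have a: "a \<in> J" "a \<in> carrier R" using c * ideal_closed(5)[OF J] by (auto simp: a_def)
  have "a \<otimes> i = inv d \<otimes> (d \<otimes> x)" using c *(4) by (simp add: a_def m_assoc)
  also have "\<dots> = x" using *(3) x by (simp add: inv_mult_Units_mult)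
  finally have ai: "x = a \<otimes> i" by simp
  then have nz: "a \<noteq> \<zero>" "i \<noteq> \<zero>" using x a c by auto
  have "J = PIdl a"
  proof
    show "PIdl a \<subseteq> J" using cgenideal_minimal[OF J a(1)] .
    show "J \<subseteq> PIdl a"
    proof
      fix y assume y: "y \<in> J"
      then have yc: "y \<in> carrier R" using ideal_closed(1)[OF J] by blast
      obtain e where e: "e \<in> carrier R" "y \<otimes> i = e \<otimes> x" using sub[OF y *(2)] by blast
      then have "y \<otimes> i = (e \<otimes> a) \<otimes> i" using ai a c by (simp add: m_assoc)
      then have "y = e \<otimes> a" using m_rcancel[OF nz(2) c(2) yc m_closed[OF e(1) a(2)]] by blast
      then show "y \<in> PIdl a" using PIdl_memI e by simp
    qed
  qed
  moreover have "I = PIdl i"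
  proof
    show "PIdl i \<subseteq> I" using cgenideal_minimal[OF I *(2)] .
    show "I \<subseteq> PIdl i"
    proof
      fix y assume y: "y \<in> I"
      then have yc: "y \<in> carrier R" using ideal_closed(1)[OF I] by blast
      obtain e where e: "e \<in> carrier R" "a \<otimes> y = e \<otimes> x" using sub[OF a(1) y] by blast
      then have "a \<otimes> y = a \<otimes> (e \<otimes> i)" using ai a c by (simp add: m_ac)
      then have "y = e \<otimes> i" using m_lcancel[OF nz(1) a(2) yc m_closed[OF e(1) c(2)]] by blast
      then show "y \<in> PIdl i" using PIdl_memI e by simp
    qed
  qed
  ultimately show thesis using that a(2) c(2) ai by blast
qed

text \<open>The factors are peeled off one at a time. The unit \<open>u\<close> stems from the empty
  product, where \<open>(x)\<close> is the whole ring.\<close>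

lemma ideal_prod_list_eq_PIdl:
  assumes "\<forall>J\<in>set Js. ideal J R" "x \<in> carrier R" "x \<noteq> \<zero>" "ideal_prod_list R Js = PIdl x"
  shows "\<exists>u ts. u \<in> Units R \<and> set ts \<subseteq> carrier R \<and> Js = map (\<lambda>t. PIdl t) ts \<and>
    x = u \<otimes> foldr (\<otimes>) ts \<one>"
  using assms
proof (induction Js arbitrary: x)
  case Nil
  then obtain r where "r \<in> carrier R" "\<one> = r \<otimes> x"
    using one_closed unfolding cgenideal_def by auto
  then have "x \<in> Units R" using Nil m_comm[of r x] unfolding Units_def by auto
  then show ?case using Nil by (intro exI[of _ x] exI[of _ "[]"]) auto
next
  case (Cons J Js)
  obtain a b where ab: "a \<in> carrier R" "b \<in> carrier R" "J = PIdl a" "ideal_prod_list R Js = PIdl b"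
    "x = a \<otimes> b"
    using ideal_prod_eq_PIdl[of J "ideal_prod_list R Js" x] Cons.prems ideal_prod_list_ideal[of Js]
    by auto
  have "b \<noteq> \<zero>" using ab Cons.prems by auto
  then obtain u ts where ts: "u \<in> Units R" "set ts \<subseteq> carrier R" "Js = map (\<lambda>t. PIdl t) ts"
    "b = u \<otimes> foldr (\<otimes>) ts \<one>"
    using Cons.IH[of b] Cons.prems(1) ab by auto
  have "x = u \<otimes> foldr (\<otimes>) (a # ts) \<one>"
    using ab ts foldr_mult_closed[OF ts(2)] by (simp add: m_ac Units_closed)
  then show ?case using ts ab by (intro exI[of _ u] exI[of _ "a # ts"]) auto
qed

section \<open>Elements that generate 2-absorbing ideals\<close>

context
  assumes princ: "\<And>x. x \<in> carrier R \<Longrightarrow> proper_ideal (PIdl x) R \<Longrightarrow> has_TA_factorization R (PIdl x)"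
begin

lemma TA_element_factorization:
  assumes x: "x \<in> M" "x \<noteq> \<zero>"
  obtains u ts where "u \<in> Units R" "ts \<noteq> []" "x = u \<otimes> foldr (\<otimes>) ts \<one>"
    "set ts \<subseteq> M - {\<zero>}" "\<And>t. t \<in> set ts \<Longrightarrow> TA_ideal (PIdl t) R" "\<And>t. t \<in> set ts \<Longrightarrow> x \<in> PIdl t"
    "PIdl x = ideal_prod_list R (map (\<lambda>t. PIdl t) ts)"
proof -
  have xc: "x \<in> carrier R" using x M_closed by blast
  then have "has_TA_factorization R (PIdl x)" using princ PIdl_proper_iff x by blast
  then obtain Js where Js: "Js \<noteq> []" "\<And>J. J \<in> set Js \<Longrightarrow> proper_ideal J R"
    "\<And>J. J \<in> set Js \<Longrightarrow> TA_ideal J R" "\<forall>J\<in>set Js. ideal J R" "PIdl x = ideal_prod_list R Js"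
    by (rule TA_factorizationE) blast
  obtain u ts where ts: "u \<in> Units R" "set ts \<subseteq> carrier R" "Js = map (\<lambda>t. PIdl t) ts"
    "x = u \<otimes> foldr (\<otimes>) ts \<one>"
    using ideal_prod_list_eq_PIdl[OF Js(4) xc x(2)] Js(5) by metis
  show thesis
  proof (rule that[OF ts(1) _ ts(4)])
    show "ts \<noteq> []" using ts(3) Js(1) by auto
    have "foldr (\<otimes>) ts \<one> \<noteq> \<zero>" using x(2) ts by (auto simp: Units_closed)
    then show "set ts \<subseteq> M - {\<zero>}"
      using Js(2) ts(2,3) PIdl_proper_iff foldr_mult_nonzero[OF ts(2)] by auto
    fix t assume t: "t \<in> set ts"
    then show "TA_ideal (PIdl t) R" using Js(3) ts(3) by auto
    show "x \<in> PIdl t"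
      using ideal_prod_list_subset_mem[OF Js(4), of "PIdl t"] t ts(3) Js(5) cgenideal_self[OF xc] by auto
  qed (use Js(5) ts(3) in simp)
qed

text \<open>Supplies the hypothesis \<open>princ\<close> of
  \<open>TA_factorization_imp_zero_primeideal\<close>: a prime containing \<open>y\<close> contains
  one of the principal 2-absorbing factors of \<open>(y)\<close>.\<close>

lemma primeideal_exists_TA_element:
  assumes Q: "primeideal Q R" and y: "y \<in> Q" "y \<noteq> \<zero>"
  shows "\<exists>t\<in>Q. t \<noteq> \<zero> \<and> TA_ideal (PIdl t) R \<and> y \<in> PIdl t"
proof -
  note Qi = primeideal_closed(1)[OF Q]
  have "y \<in> M" using y primeideal_subset_M[OF Q] by blast
  then obtain u ts where ts: "u \<in> Units R" "ts \<noteq> []" "y = u \<otimes> foldr (\<otimes>) ts \<one>"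
    "set ts \<subseteq> M - {\<zero>}" "\<And>t. t \<in> set ts \<Longrightarrow> TA_ideal (PIdl t) R" "\<And>t. t \<in> set ts \<Longrightarrow> y \<in> PIdl t"
    "PIdl y = ideal_prod_list R (map (\<lambda>t. PIdl t) ts)" using TA_element_factorization[OF _ y(2)] by metis
  have tsc: "set ts \<subseteq> carrier R" using ts(4) M_closed(1) by blast
  have "ideal_prod_list R (map (\<lambda>t. PIdl t) ts) \<subseteq> Q"
    unfolding ts(7)[symmetric] using cgenideal_minimal[OF Qi y(1)] .
  moreover have "\<forall>J\<in>set (map (\<lambda>t. PIdl t) ts). ideal J R" using tsc cgenideal_ideal by auto
  ultimately obtain J where "J \<in> set (map (\<lambda>t. PIdl t) ts)" "J \<subseteq> Q"
    using primeideal_ideal_prod_list[OF Q] by blast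
  then obtain t where t: "t \<in> set ts" "PIdl t \<subseteq> Q" by auto
  then have "t \<in> Q" using cgenideal_self tsc by blast
  then show ?thesis using t ts by blast
qed

end

lemma TAF_domain_imp_krull_dim:
  assumes "TAF_domain R"
  shows "krull_dim R = 1"
  unfolding krull_dim_eq_1_iff
proof (intro allI impI)
  fix P assume P: "primeideal P R"
  have fact: "\<And>I. proper_ideal I R \<Longrightarrow> has_TA_factorization R I"
    using assms by (simp add: TAF_domain_def)
  have "P = {\<zero>}" if "P \<noteq> M"
    by (rule TA_factorization_imp_zero_primeideal[OF fact _ P M_prime])
      (use fact primeideal_exists_TA_element primeideal_subset_M[OF P] that in auto)
  then show "P = {\<zero>} \<or> P = M" by blast
qed

text \<open>In dimension one \<open>M\<close> is the only prime over a nonzero proper ideal, so the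
  local inclusion at \<open>M\<close> applies; multipliers outside \<open>M\<close> are units and
  disappear.\<close>

lemma TA_ideal_M_square_subset:
  assumes dim: "krull_dim R = 1" and J: "TA_ideal J R" "proper_ideal J R" "J \<noteq> {\<zero>}"
  shows "M \<cdot> M \<subseteq> J"
proof
  have Ji: "ideal J R" using J(1) by (simp add: TA_ideal_def)
  have "loc_subset R M (M \<cdot> M) J"
  proof (rule TA_ideal_loc_subset[OF M_prime J(1)])
    fix P assume P: "primeideal P R" "J \<subseteq> P"
    then have "P \<noteq> {\<zero>}" using J(3) ideal_closed(2)[OF Ji] by blast
    then show "P = M" using dim P(1) krull_dim_eq_1_iff by blast
  qed
  moreover fix x assume x: "x \<in> M \<cdot> M"
  ultimately obtain s where s: "s \<in> carrier R - M" "s \<otimes> x \<in> J" unfolding loc_subset_def by blast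
  have xc: "x \<in> carrier R" using x ideal_prod_in_carrier[OF M_ideal M_ideal] by blast
  have u: "s \<in> Units R" using s mem_M_iff by blast
  then have "inv s \<otimes> (s \<otimes> x) \<in> J" using ideal_closed(5)[OF Ji _ s(2)] by simp
  then show "x \<in> J" using u xc by (simp add: inv_mult_Units_mult)
qed

lemma atom_iff: "atom R a \<longleftrightarrow> a \<in> M \<and> a \<noteq> \<zero> \<and> (\<forall>b\<in>M. \<forall>c\<in>M. a \<noteq> b \<otimes> c)"
proof -
  have "carrier R - Units R = M" using mem_M_iff by blast
  then show ?thesis unfolding atom_def using mem_M_iff by auto
qed

text \<open>If \<open>t = a \<otimes> b\<close> with nonunits, then \<open>a\<close> is an atom: a
  splitting of \<open>a\<close> would put it into \<open>M^2\<close>, hence into \<open>(t)\<close>,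
  and \<open>t = (r \<otimes> b) \<otimes> t\<close> would make \<open>b\<close> a unit. So
  \<open>t\<close> is an atom or a product of two atoms.\<close>

lemma M_square_subset_imp_atom_product:
  assumes t: "t \<in> M" "t \<noteq> \<zero>" and sub: "M \<cdot> M \<subseteq> PIdl t"
  shows "atom_product R t"
proof (cases "atom R t")
  case True
  then show ?thesis by (rule atom_product_atom)
next
  case False
  then obtain y z where yz: "y \<in> M" "z \<in> M" "t = y \<otimes> z" using t by (auto simp: atom_iff)
  have tc: "t \<in> carrier R" using t M_closed by blast
  have key: "atom R a" if ab: "a \<in> M" "b \<in> M" "t = a \<otimes> b" for a b
    unfolding atom_iff
  proof (intro conjI ballI)
    show "a \<in> M" by fact
    show "a \<noteq> \<zero>" using t ab M_closed(1) by auto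
    fix p q assume pq: "p \<in> M" "q \<in> M"
    show "a \<noteq> p \<otimes> q"
    proof
      assume "a = p \<otimes> q"
      then have "a \<in> M \<cdot> M" using pq ideal_prod.prod[of p M q M R] by simp
      then obtain r where r: "r \<in> carrier R" "a = r \<otimes> t" using sub by (auto simp: cgenideal_def)
      have bc: "b \<in> carrier R" using ab M_closed(1) by blast
      have "\<one> \<otimes> t = (r \<otimes> b) \<otimes> t" using r ab(3) tc bc by (metis l_one m_assoc m_comm)
      then have "\<one> = r \<otimes> b" using m_rcancel[OF t(2) tc] r bc by blast
      then show False using M_closed(5)[OF r(1) ab(2)] one_notin_M by simp
    qed
  qed
  have "t = z \<otimes> y" using yz m_comm M_closed(1) by simp
  then have "atom R y" "atom R z" using key yz by blast+
  then show ?thesis unfolding yz(3) by (intro atom_product_mult atom_product_atom)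
qed

lemma principal_TA_factorization_imp_atoms:
  assumes dim: "krull_dim R = 1"
    and princ: "\<And>x. x \<in> carrier R \<Longrightarrow> proper_ideal (PIdl x) R \<Longrightarrow> has_TA_factorization R (PIdl x)"
  shows "atomic R" "\<And>a. atom R a \<Longrightarrow> TA_ideal (PIdl a) R"
proof -
  show "atomic R"
    unfolding atomic_iff_atom_product
  proof (intro ballI impI)
    fix x assume x: "x \<in> carrier R" "x \<noteq> \<zero>" "x \<notin> Units R"
    then have "x \<in> M" using mem_M_iff by blast
    then obtain u ts where ts: "u \<in> Units R" "ts \<noteq> []" "x = u \<otimes> foldr (\<otimes>) ts \<one>"
      "set ts \<subseteq> M - {\<zero>}" "\<And>t. t \<in> set ts \<Longrightarrow> TA_ideal (PIdl t) R"
      using TA_element_factorization[OF princ _ x(2)] by metis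
    have "atom_product R t" if "t \<in> set ts" for t
    proof (rule M_square_subset_imp_atom_product)
      have t: "t \<in> M" "t \<noteq> \<zero>" "t \<in> carrier R" using that ts(4) M_closed(1) by auto
      then show "t \<in> M" "t \<noteq> \<zero>" by auto
      show "M \<cdot> M \<subseteq> PIdl t"
        using t ts(5)[OF that] PIdl_proper_iff cgenideal_self[OF t(3)]
        by (intro TA_ideal_M_square_subset[OF dim]) auto
    qed
    then have "atom_product R (foldr (\<otimes>) ts \<one>)"
      by (induction ts) (auto intro: atom_product_one atom_product_mult)
    moreover have "set ts \<subseteq> carrier R" using ts(4) M_closed(1) by blast
    then have "foldr (\<otimes>) ts \<one> \<notin> Units R"
      using x(3) ts(1,3) Units_mult_cancel_iff foldr_mult_closed by blast
    ultimately show "atom_product R x" using ts atom_product_Units_mult by blast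
  qed
  fix a assume a: "atom R a"
  then have aM: "a \<in> M" "a \<noteq> \<zero>" "a \<in> carrier R" by (auto simp: atom_iff M_closed(1))
  then obtain u ts where ts: "u \<in> Units R" "ts \<noteq> []" "a = u \<otimes> foldr (\<otimes>) ts \<one>"
    "set ts \<subseteq> M - {\<zero>}" "\<And>t. t \<in> set ts \<Longrightarrow> TA_ideal (PIdl t) R" "\<And>t. t \<in> set ts \<Longrightarrow> a \<in> PIdl t"
    using TA_element_factorization[OF princ _ aM(2)] by metis
  \<comment> \<open>As \<open>a\<close> is an atom, the cofactor \<open>u \<otimes> r\<close> of the
    first factor \<open>t\<close> is a unit. Hence \<open>a\<close> and \<open>t\<close> generate
    the same ideal, and that of \<open>t\<close> is 2-absorbing.\<close>
  obtain t rs where t: "ts = t # rs" using ts(2) by (cases ts) auto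
  define r where "r = foldr (\<otimes>) rs \<one>"
  have c: "r \<in> carrier R" "t \<in> M" "t \<in> carrier R" "u \<in> carrier R"
    using ts(1,4) t M_closed(1) foldr_mult_closed[of rs] by (auto simp: r_def)
  have at: "a = (u \<otimes> r) \<otimes> t" using ts(3) t c by (simp add: r_def m_ac)
  have "u \<otimes> r \<notin> M" using a c at by (auto simp: atom_iff)
  then have ur: "u \<otimes> r \<in> Units R" using mem_M_iff c by simp
  then have "inv (u \<otimes> r) \<otimes> a = t" unfolding at using c(3) by (rule inv_mult_Units_mult)
  then have "t \<in> PIdl a" using PIdl_memI[of "inv (u \<otimes> r)" a] ur by simp
  moreover have "a \<in> PIdl t" using ts(6) t by simp
  ultimately have "PIdl a = PIdl t"
    using cgenideal_minimal[OF cgenideal_ideal[OF aM(3)]] cgenideal_minimal[OF cgenideal_ideal[OF c(3)]]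
    by blast
  then show "TA_ideal (PIdl a) R" using ts(5) t by simp
qed

lemma TA_atoms_imp_universal:
  assumes dim: "krull_dim R = 1" and TA: "\<And>a. atom R a \<Longrightarrow> TA_ideal (PIdl a) R"
  shows "universal_ideal R (M \<cdot> M)"
  unfolding universal_ideal_def
proof (intro allI impI)
  fix a assume a: "atom R a"
  then have aM: "a \<in> M" "a \<noteq> \<zero>" "a \<in> carrier R" by (auto simp: atom_iff M_closed(1))
  then show "M \<cdot> M \<subseteq> PIdl a"
    using TA[OF a] PIdl_proper_iff cgenideal_self[OF aM(3)]
    by (intro TA_ideal_M_square_subset[OF dim]) auto
qed

text \<open>A converse to \<open>TA_ideal_M_square_subset\<close>: if
  \<open>a \<otimes> b \<otimes> c \<in> I\<close>, either \<open>a\<close> and \<open>b\<close> are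
  both nonunits, and \<open>a \<otimes> b \<in> M^2\<close>, or one of them is a unit and
  cancels.\<close>

lemma M_square_subset_imp_TA_ideal:
  assumes I: "ideal I R" "I \<subseteq> M" and sub: "M \<cdot> M \<subseteq> I"
  shows "TA_ideal I R"
  unfolding TA_ideal_def
proof (intro conjI ballI impI I(1))
  fix a b c assume abc: "a \<in> carrier R" "b \<in> carrier R" "c \<in> carrier R" "a \<otimes> b \<otimes> c \<in> I"
  have mm: "x \<otimes> y \<in> I" if "x \<in> M" "y \<in> M" for x y
    using ideal_prod.prod[OF that, of R] sub by blast
  have cancel: "x \<in> I" if "u \<in> carrier R" "u \<notin> M" "x \<in> carrier R" "u \<otimes> x \<in> I" for u x
  proof -
    have u: "u \<in> Units R" using that mem_M_iff by blast
    then have "inv u \<otimes> (u \<otimes> x) \<in> I" using ideal_closed(5)[OF I(1) _ that(4)] by simp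
    then show ?thesis using u that by (simp add: inv_mult_Units_mult)
  qed
  consider "a \<in> M" "b \<in> M" | "a \<notin> M" | "b \<notin> M" by blast
  then show "a \<otimes> b \<in> I \<or> a \<otimes> c \<in> I \<or> b \<otimes> c \<in> I"
  proof cases
    case 1
    then show ?thesis using mm by blast
  next
    case 2
    then have "b \<otimes> c \<in> I" using cancel[of a "b \<otimes> c"] abc by (simp add: m_assoc)
    then show ?thesis by blast
  next
    case 3
    then have "a \<otimes> c \<in> I" using cancel[of b "a \<otimes> c"] abc by (simp add: m_ac)
    then show ?thesis by blast
  qed
qed

end

section \<open>Local domains inside their quotient field\<close>

lemma (in field) inv_facts:
  assumes "x \<in> carrier R" "x \<noteq> \<zero>"
  shows "inv x \<in> carrier R" "inv x \<noteq> \<zero>" "x \<otimes> inv x = \<one>" "inv x \<otimes> x = \<one>"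
    "inv (inv x) = x"
    "\<And>y. y \<in> carrier R \<Longrightarrow> x \<otimes> (inv x \<otimes> y) = y" "\<And>y. y \<in> carrier R \<Longrightarrow> inv x \<otimes> (x \<otimes> y) = y"
proof -
  have u: "x \<in> Units R" using assms field_Units by blast
  then show i: "inv x \<in> carrier R" and r: "x \<otimes> inv x = \<one>" and l: "inv x \<otimes> x = \<one>"
    and "inv (inv x) = x" by auto
  show "inv x \<noteq> \<zero>" using r assms by auto
  show "\<And>y. y \<in> carrier R \<Longrightarrow> x \<otimes> (inv x \<otimes> y) = y"
    using i r assms by (metis l_one m_assoc)
  show "\<And>y. y \<in> carrier R \<Longrightarrow> inv x \<otimes> (x \<otimes> y) = y"
    using i l assms by (metis l_one m_assoc)
qed

lemma (in field) nat_pow_nonzero: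
  "x \<in> carrier R \<Longrightarrow> x \<noteq> \<zero> \<Longrightarrow> x [^] (n::nat) \<noteq> \<zero>"
  by (induction n) (auto simp: integral_iff)

lemma (in field) inv_mult_field:
  assumes "x \<in> carrier R" "x \<noteq> \<zero>" "y \<in> carrier R" "y \<noteq> \<zero>"
  shows "inv (x \<otimes> y) = inv x \<otimes> inv y"
proof (rule comm_inv_char)
  have "(x \<otimes> y) \<otimes> (inv x \<otimes> inv y) = (x \<otimes> inv x) \<otimes> (y \<otimes> inv y)"
    using assms inv_facts(1) by (simp add: m_ac)
  then show "(x \<otimes> y) \<otimes> (inv x \<otimes> inv y) = \<one>" using assms inv_facts(3) by simp
qed (use assms inv_facts(1) in auto)

locale local_subdomain = field K for K (structure) +
  fixes D M
  assumes quotient: "quotient_field K D"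
    and local: "local_ring (K\<lparr>carrier := D\<rparr>) M"
    and not_field: "\<not> field (K\<lparr>carrier := D\<rparr>)"
begin

abbreviation R where "R \<equiv> K\<lparr>carrier := D\<rparr>"
abbreviation V where "V \<equiv> self_colon K M"
abbreviation RV where "RV \<equiv> K\<lparr>carrier := V\<rparr>"

lemma D_subring: "subring D K"
  using quotient by (simp add: quotient_field_def)

lemmas D_closed = subringE[OF D_subring]

sublocale R: local_nonfield_domain R M
  using subring_is_domain[OF D_subring] local not_field
  by (intro local_nonfield_domain.intro local_nonfield_domain_axioms.intro)

lemma M_closed:
  "\<And>x. x \<in> M \<Longrightarrow> x \<in> D" "\<And>x. x \<in> M \<Longrightarrow> x \<in> carrier K" "\<zero> \<in> M"
  "\<And>x y. x \<in> M \<Longrightarrow> y \<in> M \<Longrightarrow> x \<oplus> y \<in> M"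
  "\<And>d x. d \<in> D \<Longrightarrow> x \<in> M \<Longrightarrow> d \<otimes> x \<in> M"
  "\<And>x. x \<in> M \<Longrightarrow> \<ominus> x \<in> M"
proof -
  show D: "\<And>x. x \<in> M \<Longrightarrow> x \<in> D" using R.M_closed(1) by simp
  then show c: "\<And>x. x \<in> M \<Longrightarrow> x \<in> carrier K" using D_closed(1) by blast
  show "\<zero> \<in> M" using R.M_closed(2) by simp
  show "\<And>x y. x \<in> M \<Longrightarrow> y \<in> M \<Longrightarrow> x \<oplus> y \<in> M" using R.M_closed(3) by simp
  show m: "\<And>d x. d \<in> D \<Longrightarrow> x \<in> M \<Longrightarrow> d \<otimes> x \<in> M" using R.M_closed(5) by simp
  fix x assume "x \<in> M"
  then show "\<ominus> x \<in> M" using m[of "\<ominus> \<one>" x] D_closed(3,5) c by (simp add: l_minus)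
qed

lemma one_notin_M: "\<one> \<notin> M"
  using R.one_notin_M by simp

lemma M_nonzero: obtains m where "m \<in> M" "m \<noteq> \<zero>"
  using R.M_nonzero M_closed(3) by auto

lemma inv_mem_D:
  assumes "x \<in> D" "x \<notin> M"
  shows "inv x \<in> D"
proof -
  have "x \<in> Units R" using R.mem_M_iff assms by simp
  then obtain y where y: "y \<in> D" "x \<otimes> y = \<one>" unfolding Units_def by auto
  then have "inv x = y" using assms D_closed(1) by (intro comm_inv_char) auto
  then show ?thesis using y by simp
qed

lemma PIdl_R_iff: "y \<in> PIdl\<^bsub>R\<^esub> a \<longleftrightarrow> (\<exists>d\<in>D. y = d \<otimes> a)"
  by (auto simp: cgenideal_def)

lemma atom_R_iff: "atom R a \<longleftrightarrow> a \<in> M \<and> a \<noteq> \<zero> \<and> (\<forall>b\<in>M. \<forall>c\<in>M. a \<noteq> b \<otimes> c)"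
  using R.atom_iff by simp

section \<open>The overring \<open>(M:M)\<close>\<close>

lemma V_iff: "x \<in> V \<longleftrightarrow> x \<in> carrier K \<and> (\<forall>m\<in>M. x \<otimes> m \<in> M)"
  by (auto simp: self_colon_def)

lemma V_mult_M: "v \<in> V \<Longrightarrow> m \<in> M \<Longrightarrow> v \<otimes> m \<in> M"
  by (simp add: V_iff)

lemma D_subset_V: "D \<subseteq> V"
  using D_closed(1) M_closed(5) by (auto simp: V_iff)

lemma M_subset_V: "M \<subseteq> V"
  using M_closed(1) D_subset_V by blast

lemma V_subring: "subring V K"
proof (rule subringI)
  show "V \<subseteq> carrier K" by (auto simp: V_iff)
  show "\<one> \<in> V" using D_closed(3) D_subset_V by blast
  show "\<ominus> h \<in> V" if "h \<in> V" for h
    using that M_closed by (auto simp: V_iff l_minus)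
  show "h1 \<otimes> h2 \<in> V" if "h1 \<in> V" "h2 \<in> V" for h1 h2
    using that M_closed(2) by (auto simp: V_iff m_assoc)
  show "h1 \<oplus> h2 \<in> V" if "h1 \<in> V" "h2 \<in> V" for h1 h2
    using that M_closed(2,4) by (auto simp: V_iff l_distr)
qed

lemmas V_closed = subringE[OF V_subring]

lemma RV_domain: "domain RV"
  using subring_is_domain[OF V_subring] .

lemma RV_not_field: "\<not> field RV"
proof
  assume "field RV"
  then interpret RV: field RV .
  obtain m where m: "m \<in> M" "m \<noteq> \<zero>" by (rule M_nonzero)
  then have "m \<in> Units RV" using RV.field_Units M_subset_V by auto
  then obtain v where "v \<in> V" "v \<otimes> m = \<one>" unfolding Units_def by auto
  then show False using V_mult_M[of v m] m one_notin_M by simp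
qed

lemma V_ideal_iff:
  "ideal I RV \<longleftrightarrow> I \<subseteq> V \<and> \<zero> \<in> I \<and> (\<forall>x\<in>I. \<forall>y\<in>I. x \<oplus> y \<in> I) \<and> (\<forall>v\<in>V. \<forall>x\<in>I. v \<otimes> x \<in> I)"
proof -
  interpret RV: domain RV by (rule RV_domain)
  show ?thesis
  proof
    assume "ideal I RV"
    from RV.ideal_closed[OF this]
    show "I \<subseteq> V \<and> \<zero> \<in> I \<and> (\<forall>x\<in>I. \<forall>y\<in>I. x \<oplus> y \<in> I) \<and> (\<forall>v\<in>V. \<forall>x\<in>I. v \<otimes> x \<in> I)"
      by auto
  qed (intro RV.idealI_elementwise; auto)
qed

lemma M_ideal_V: "ideal M RV"
  unfolding V_ideal_iff
  by (intro conjI ballI M_subset_V M_closed(3)) (use M_closed(4) V_mult_M in auto)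

text \<open>The unit group of \<open>V\<close>, with inverses taken in \<open>K\<close>, so that
  computations in \<open>D\<close>, \<open>V\<close> and \<open>K\<close> share one inverse.\<close>

definition V_units where
  "V_units = {u \<in> V. u \<noteq> \<zero> \<and> inv u \<in> V}"

lemma V_units_closed:
  assumes "u \<in> V_units"
  shows "u \<in> V" "u \<in> carrier K" "u \<noteq> \<zero>" "inv u \<in> V_units" "u \<notin> M"
    "\<And>v. v \<in> V_units \<Longrightarrow> u \<otimes> v \<in> V_units" "\<And>m. m \<in> M \<Longrightarrow> u \<otimes> m \<in> M"
proof -
  show u: "u \<in> V" "u \<in> carrier K" "u \<noteq> \<zero>" using assms V_closed(1) by (auto simp: V_units_def)
  show i: "inv u \<in> V_units" using inv_facts[OF u(2,3)] assms by (auto simp: V_units_def)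
  show "u \<notin> M"
  proof
    assume "u \<in> M"
    then have "inv u \<otimes> u \<in> M" using i V_mult_M by (auto simp: V_units_def)
    then show False using inv_facts[OF u(2,3)] one_notin_M by simp
  qed
  show "u \<otimes> v \<in> V_units" if v: "v \<in> V_units" for v
  proof -
    have "v \<in> V" "v \<in> carrier K" "v \<noteq> \<zero>" "inv v \<in> V" using v V_closed(1) by (auto simp: V_units_def)
    then show ?thesis using u assms inv_mult_field[of u v] V_closed(6)
      by (auto simp: V_units_def integral_iff)
  qed
  show "\<And>m. m \<in> M \<Longrightarrow> u \<otimes> m \<in> M" using V_mult_M u by blast
qed

lemma one_V_units: "\<one> \<in> V_units"
  using V_closed(3) by (auto simp: V_units_def)

lemma local_imp_V_units:
  assumes "local_ring RV M" "x \<in> V" "x \<notin> M"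
  shows "x \<in> V_units"
proof -
  interpret RV: local_nonfield_domain RV M
    using RV_domain assms(1) RV_not_field
    by (intro local_nonfield_domain.intro local_nonfield_domain_axioms.intro)
  have "x \<in> Units RV" using RV.mem_M_iff assms by simp
  then obtain y where y: "y \<in> V" "x \<otimes> y = \<one>" unfolding Units_def by auto
  then have "inv x = y" using assms V_closed(1) by (intro comm_inv_char) auto
  moreover have "x \<noteq> \<zero>" using M_closed(3) assms(3) by auto
  ultimately show ?thesis using y assms(2) by (simp add: V_units_def)
qed

text \<open>\<open>p\<close> generates \<open>M\<close> over \<open>V\<close>, not over
  \<open>D\<close>: the coefficients \<open>u\<close> are units of \<open>V\<close> and may lie
  outside \<open>D\<close>. The exponent \<open>Suc n\<close> records that elements of
  \<open>M\<close> have positive valuation.\<close>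

definition uniformizer where
  "uniformizer p \<longleftrightarrow> p \<in> M \<and> p \<noteq> \<zero> \<and>
     (\<forall>x\<in>M - {\<zero>}. \<exists>u\<in>V_units. \<exists>n. x = u \<otimes> p [^] Suc n)"

text \<open>Any atom serves as \<open>p\<close>, because two atoms differ by a unit of
  \<open>V\<close>; the exponent of \<open>x\<close> is then the number of atoms in a factorization
  of \<open>x\<close>.\<close>

lemma atomic_universal_imp_uniformizer:
  assumes "atomic R" "universal_ideal R (ideal_prod R M M)"
  obtains p where "uniformizer p"
proof -
  have V: "b \<otimes> inv a \<in> V" if "atom R a" "atom R b" for a b
  proof -
    have a: "a \<in> M" "a \<noteq> \<zero>" "a \<in> carrier K" and b: "b \<in> M" "b \<noteq> \<zero>" "b \<in> carrier K"
      using that M_closed(2) by (auto simp: atom_R_iff)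
    have "(b \<otimes> inv a) \<otimes> m \<in> M" if m: "m \<in> M" for m
    proof -
      have "b \<otimes> m \<in> ideal_prod R M M" using ideal_prod.prod[OF b(1) m, of R] by simp
      then have "b \<otimes> m \<in> PIdl\<^bsub>R\<^esub> a" using assms(2) \<open>atom R a\<close> unfolding universal_ideal_def by blast
      then obtain d where d: "d \<in> D" "b \<otimes> m = d \<otimes> a" by (auto simp: PIdl_R_iff)
      have dc: "d \<in> carrier K" "m \<in> carrier K" using d D_closed(1) m M_closed(2) by auto
      \<comment> \<open>If \<open>d\<close> were a unit,
        \<open>a = (inv d \<otimes> m) \<otimes> b\<close> would be a product of two elements of
        \<open>M\<close>. So \<open>b \<otimes> inv a\<close> maps \<open>M\<close> into
        \<open>M\<close>; exchanging the two atoms treats its inverse.\<close>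
      have "d \<in> M"
      proof (rule ccontr)
        assume "d \<notin> M"
        then have i: "inv d \<in> D" "d \<noteq> \<zero>" using inv_mem_D d M_closed(3) by auto
        have "a = inv d \<otimes> (d \<otimes> a)" using inv_facts(7)[OF dc(1) i(2) a(3)] by simp
        also have "\<dots> = (inv d \<otimes> m) \<otimes> b"
          unfolding d(2)[symmetric] using i D_closed(1) dc b by (auto simp: m_ac)
        finally show False
          using \<open>atom R a\<close> M_closed(5)[OF i(1) m] b(1) unfolding atom_R_iff by blast
      qed
      moreover have "(b \<otimes> inv a) \<otimes> m = inv a \<otimes> (b \<otimes> m)"
        using b dc inv_facts[OF a(3,2)] by (simp add: m_ac)
      moreover have "\<dots> = d"
        unfolding d(2) using inv_facts[OF a(3,2)] a dc by (simp add: m_comm[of d a])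
      ultimately show ?thesis by simp
    qed
    then show ?thesis using a b inv_facts by (simp add: V_iff)
  qed
  have U: "b \<otimes> inv a \<in> V_units" if ab: "atom R a" "atom R b" for a b
  proof -
    have a: "a \<noteq> \<zero>" "a \<in> carrier K" and b: "b \<noteq> \<zero>" "b \<in> carrier K"
      using that M_closed(2) by (auto simp: atom_R_iff)
    have "inv (b \<otimes> inv a) = a \<otimes> inv b"
      using inv_mult_field[of b "inv a"] a b inv_facts by (simp add: m_comm)
    then show ?thesis using V[OF ab] V[OF ab(2,1)] a b inv_facts
      by (auto simp: V_units_def integral_iff)
  qed
  \<comment> \<open>A nonempty list is required both to find a first atom \<open>p\<close> and to
    get positive exponents.\<close>
  have nonempty: "\<exists>as. as \<noteq> [] \<and> (\<forall>a\<in>set as. atom R a) \<and> x = foldr (\<otimes>) as \<one>"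
    if x: "x \<in> M" "x \<noteq> \<zero>" for x
  proof -
    have "x \<in> D" "x \<notin> Units R" using x R.mem_M_iff[of x] by auto
    then obtain as where as: "\<forall>a\<in>set as. atom R a" "x = foldr (\<otimes>) as \<one>"
      using assms(1) x(2) unfolding atomic_def by auto
    then have "as \<noteq> []" using x one_notin_M by auto
    then show ?thesis using as by blast
  qed
  obtain m where "m \<in> M" "m \<noteq> \<zero>" by (rule M_nonzero)
  then obtain as where "as \<noteq> []" "\<forall>a\<in>set as. atom R a" using nonempty by blast
  then obtain p where p: "atom R p" by (cases as) auto
  then have pM: "p \<in> M" "p \<noteq> \<zero>" "p \<in> carrier K" using M_closed(2) by (auto simp: atom_R_iff)
  have rep: "\<exists>u\<in>V_units. foldr (\<otimes>) as \<one> = u \<otimes> p [^] length as" if "\<forall>a\<in>set as. atom R a" for as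
    using that
  proof (induction as)
    case Nil
    then show ?case using one_V_units by (intro bexI[of _ \<one>]) auto
  next
    case (Cons a as)
    then obtain u where u: "u \<in> V_units" "foldr (\<otimes>) as \<one> = u \<otimes> p [^] length as" by auto
    have a: "atom R a" "a \<in> carrier K" using Cons M_closed(2) by (auto simp: atom_R_iff)
    have uc: "u \<in> carrier K" using V_units_closed(2) u by blast
    have "((a \<otimes> inv p) \<otimes> u) \<otimes> p [^] length (a # as) =
        a \<otimes> (u \<otimes> (inv p \<otimes> (p \<otimes> p [^] length as)))"
      using a uc pM inv_facts(1)[OF pM(3,2)] by (simp add: m_ac)
    also have "\<dots> = a \<otimes> foldr (\<otimes>) as \<one>"
      using inv_facts(7)[OF pM(3,2)] pM u by simp
    finally have "foldr (\<otimes>) (a # as) \<one> = ((a \<otimes> inv p) \<otimes> u) \<otimes> p [^] length (a # as)" by simp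
    moreover have "(a \<otimes> inv p) \<otimes> u \<in> V_units" using U[OF p a(1)] u V_units_closed(6) by blast
    ultimately show ?case by blast
  qed
  have "uniformizer p"
    unfolding uniformizer_def
  proof (intro conjI ballI pM(1,2))
    fix x assume x: "x \<in> M - {\<zero>}"
    then obtain as where as: "as \<noteq> []" "\<forall>a\<in>set as. atom R a" "x = foldr (\<otimes>) as \<one>"
      using nonempty by blast
    then obtain b bs where "as = b # bs" by (cases as) auto
    then have "length as = Suc (length bs)" by simp
    then show "\<exists>u\<in>V_units. \<exists>n. x = u \<otimes> p [^] Suc n" using rep[OF as(2)] as(3) by metis
  qed
  then show thesis using that by blast
qed

text \<open>A generator \<open>p\<close> of \<open>M\<close> serves. If some nonzero
  \<open>x \<in> M\<close> were not a unit times a power of \<open>p\<close>, it could be divided by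
  \<open>p\<close> again and again without leaving \<open>M\<close>, and the quotients would
  generate an endless ascending chain in \<open>V\<close>.\<close>

lemma DVR_imp_uniformizer:
  assumes "DVR RV M"
  obtains p where "uniformizer p"
proof -
  interpret RV: principal_domain RV using assms by (simp add: DVR_def)
  have loc: "local_ring RV M" using assms by (simp add: DVR_def)
  obtain p where p: "p \<in> V" "M = PIdl\<^bsub>RV\<^esub> p" using RV.exists_gen[OF M_ideal_V] by auto
  have "PIdl\<^bsub>RV\<^esub> p = {v \<otimes> p | v. v \<in> V}" by (auto simp: cgenideal_def)
  then have M: "x \<in> M \<longleftrightarrow> (\<exists>v\<in>V. x = v \<otimes> p)" for x using p(2) by blast
  have pc: "p \<in> carrier K" using p V_closed(1) by blast
  have pM: "p \<in> M" unfolding M using V_closed(3) pc by (intro bexI[of _ \<one>]) auto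
  have p0: "p \<noteq> \<zero>"
  proof
    assume "p = \<zero>"
    then have "x = \<zero>" if "x \<in> M" for x using that V_closed(1) by (auto simp: M)
    then show False using M_nonzero by blast
  qed
  note pow0 = nat_pow_nonzero[OF pc p0]
  have "\<exists>u\<in>V_units. \<exists>n. x = u \<otimes> p [^] Suc n" if x: "x \<in> M - {\<zero>}" for x
  proof (rule ccontr)
    assume no: "\<not> ?thesis"
    have xc: "x \<in> carrier K" "x \<noteq> \<zero>" using x M_closed(2) by auto
    define y where "y n = x \<otimes> inv (p [^] n)" for n :: nat
    have yc: "y n \<in> carrier K" for n unfolding y_def using xc pc inv_facts(1) pow0 by simp
    have y0: "y n \<noteq> \<zero>" for n
      unfolding y_def using xc pc inv_facts(1,2)[OF _ pow0] by (simp add: integral_iff)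
    have xy: "x = y n \<otimes> p [^] n" for n
      unfolding y_def using xc pc inv_facts(1,4)[OF _ pow0] by (simp add: m_assoc)
    have step: "y n = y (Suc n) \<otimes> p" for n
    proof -
      have "y (Suc n) \<otimes> p = x \<otimes> (inv (p [^] n) \<otimes> (inv p \<otimes> p))"
        unfolding y_def using xc pc inv_facts(1)[OF pc p0] inv_facts(1)[OF _ pow0]
          inv_mult_field[OF _ pow0 pc p0] by (simp add: m_ac)
      then show ?thesis
        using inv_facts(4)[OF pc p0] inv_facts(1)[OF _ pow0] pc by (simp add: y_def)
    qed
    have yM: "y n \<in> M" for n
    proof (induction n)
      case 0
      then show ?case using x xc by (simp add: y_def)
    next
      case (Suc n)
      then obtain v where v: "v \<in> V" "y n = v \<otimes> p" by (auto simp: M)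
      then have "v = y (Suc n)"
        using step[of n] m_rcancel[OF p0 pc] yc V_closed(1) by (metis subsetD)
      then have yV: "y (Suc n) \<in> V" using v by simp
      show ?case
      proof (rule ccontr)
        assume "y (Suc n) \<notin> M"
        then have "y (Suc n) \<in> V_units" using local_imp_V_units[OF loc yV] by blast
        then show False using no xy[of "Suc n"] by blast
      qed
    qed
    \<comment> \<open>The union of the ideals generated by the \<open>y n\<close>, which increase
      because \<open>y n = y (Suc n) \<otimes> p\<close>. A generator \<open>z\<close> already lies
      in one of them, so \<open>y (Suc n)\<close> is a multiple of \<open>y n\<close>, and
      cancelling \<open>y (Suc n)\<close> would make \<open>p\<close> a unit of
      \<open>V\<close>.\<close>
    define I where "I = {v \<otimes> y n | v n. v \<in> V}"
    have le: "\<exists>w\<in>V. y n = w \<otimes> y (n + k)" for n k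
    proof (induction k)
      case 0
      then show ?case using yc V_closed(3) by (intro bexI[of _ \<one>]) auto
    next
      case (Suc k)
      then obtain w where w: "w \<in> V" "y n = w \<otimes> y (n + k)" by blast
      then have "y n = (w \<otimes> p) \<otimes> y (n + Suc k)"
        using step[of "n + k"] V_closed(1) pc yc by (auto simp: m_ac)
      then show ?case using w V_closed(6) p by blast
    qed
    have "ideal I RV"
      unfolding V_ideal_iff
    proof (intro conjI ballI)
      show "I \<subseteq> V" using yM M_subset_V V_closed(6) by (auto simp: I_def)
      show "\<zero> \<in> I" unfolding I_def using V_closed(2) yc l_null by (metis (mono_tags, lifting) CollectI)
      fix a b assume "a \<in> I" "b \<in> I"
      then obtain v w m n where *: "v \<in> V" "w \<in> V" "a = v \<otimes> y m" "b = w \<otimes> y n"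
        unfolding I_def by blast
      obtain r where r: "r \<in> V" "y m = r \<otimes> y (m + n)" using le by blast
      obtain s where s: "s \<in> V" "y n = s \<otimes> y (m + n)" using le[of n m] by (auto simp: add.commute)
      have "a \<oplus> b = (v \<otimes> r \<oplus> w \<otimes> s) \<otimes> y (m + n)"
        unfolding *(3,4) r(2) s(2) using *(1,2) r(1) s(1) V_closed(1) yc[of "m + n"]
        by (simp add: l_distr m_assoc subset_iff)
      moreover have "v \<otimes> r \<oplus> w \<otimes> s \<in> V" using * r s V_closed(6,7) by simp
      ultimately show "a \<oplus> b \<in> I" unfolding I_def by blast
    next
      fix v a assume v: "v \<in> V" and "a \<in> I"
      then obtain w n where w: "w \<in> V" "a = w \<otimes> y n" unfolding I_def by blast
      then have "v \<otimes> a = (v \<otimes> w) \<otimes> y n" using v V_closed(1) yc by (simp add: m_assoc subset_iff)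
      then show "v \<otimes> a \<in> I" unfolding I_def using v w V_closed(6) by blast
    qed
    then obtain z where z: "z \<in> V" "I = PIdl\<^bsub>RV\<^esub> z" using RV.exists_gen by auto
    then have "z \<in> I" using RV.cgenideal_self[of z] by simp
    then obtain v n where v: "v \<in> V" "z = v \<otimes> y n" unfolding I_def by blast
    have "y (Suc n) = \<one> \<otimes> y (Suc n)" using yc by simp
    then have "y (Suc n) \<in> I" unfolding I_def using V_closed(3) by blast
    then obtain w where w: "w \<in> V" "y (Suc n) = w \<otimes> z"
      using z by (auto simp: cgenideal_def)
    have c: "v \<in> carrier K" "w \<in> carrier K" using v w V_closed(1) by auto
    have "y (Suc n) = w \<otimes> (v \<otimes> (y (Suc n) \<otimes> p))" using w(2) v(2) step[of n] by simp
    then have "\<one> \<otimes> y (Suc n) = ((w \<otimes> v) \<otimes> p) \<otimes> y (Suc n)"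
      using c pc yc[of "Suc n"] by (simp add: m_ac)
    then have "\<one> = (w \<otimes> v) \<otimes> p"
      using m_rcancel[OF y0 yc] c pc by (metis m_closed one_closed)
    then show False using V_mult_M[of "w \<otimes> v" p] pM one_notin_M v w V_closed(6) by simp
  qed
  then have "uniformizer p" unfolding uniformizer_def using pM p0 by blast
  then show thesis using that by blast
qed

text \<open>Comparability in \<open>V\<close> gives \<open>M \<subseteq> aV\<close> for an atom
  \<open>a\<close>: if \<open>a = y \<otimes> v\<close> with \<open>y \<in> M\<close>, then
  \<open>v\<close> is outside \<open>M\<close> and so a unit of \<open>V\<close>. A second factor
  from \<open>M\<close> leads back to the domain:
  \<open>M^2 \<subseteq> aVM \<subseteq> aM\<close>.\<close>

lemma PVD_imp_universal:
  assumes "PVD K D M"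
  shows "universal_ideal R (ideal_prod R M M)"
proof -
  have V: "valuation_domain RV" "local_ring RV M"
    using assms not_field unfolding PVD_def Let_def by blast+
  have val: "a divides\<^bsub>RV\<^esub> b \<or> b divides\<^bsub>RV\<^esub> a" if "a \<in> V" "b \<in> V" for a b
    using V(1) that by (simp add: valuation_domain_def)
  show ?thesis
    unfolding universal_ideal_def
  proof (intro allI impI)
    fix a assume a: "atom R a"
    then have aM: "a \<in> M" "a \<in> D" "a \<in> carrier K"
      using M_closed(1,2) by (auto simp: atom_R_iff)
    show "ideal_prod R M M \<subseteq> PIdl\<^bsub>R\<^esub> a"
    proof (rule R.ideal_prod_subset)
      show "ideal (PIdl\<^bsub>R\<^esub> a) R" using R.cgenideal_ideal aM by simp
      fix y z assume yz: "y \<in> M" "z \<in> M"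
      have c: "y \<in> carrier K" "z \<in> carrier K" using yz M_closed(2) by auto
      have "\<exists>v\<in>V. y = a \<otimes> v"
      proof (cases "a divides\<^bsub>RV\<^esub> y")
        case True
        then show ?thesis by (auto simp: factor_def)
      next
        case False
        then have "y divides\<^bsub>RV\<^esub> a"
          using val[OF subsetD[OF M_subset_V aM(1)] subsetD[OF M_subset_V yz(1)]] by simp
        then obtain v where v: "v \<in> V" "a = y \<otimes> v" by (auto simp: factor_def)
        then have "v \<notin> M" using a yz unfolding atom_R_iff by blast
        then have u: "v \<in> V_units" using local_imp_V_units[OF V(2)] v by blast
        note vc = V_units_closed(2,3)[OF u]
        have "a \<otimes> inv v = y \<otimes> (v \<otimes> inv v)"
          unfolding v(2) using inv_facts(1)[OF vc] vc c by (simp add: m_assoc)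
        then have "y = a \<otimes> inv v" using inv_facts(3)[OF vc] c by simp
        then show ?thesis using V_units_closed(1)[OF V_units_closed(4)[OF u]] by blast
      qed
      then obtain v where v: "v \<in> V" "y = a \<otimes> v" by blast
      then have "y \<otimes> z = (v \<otimes> z) \<otimes> a" using aM c V_closed(1) by (simp add: m_ac subset_iff)
      then show "y \<otimes>\<^bsub>R\<^esub> z \<in> PIdl\<^bsub>R\<^esub> a"
        using V_mult_M[OF v(1) yz(2)] M_closed(1) by (auto simp: PIdl_R_iff)
    qed
  qed
qed

text \<open>The chain condition concerns ideals of \<open>D\<close>, whereas the powers of
  \<open>x\<close> live in \<open>V\<close>. Multiplication by a nonzero \<open>m \<in> M\<close>
  maps \<open>V\<close> injectively into \<open>M\<close> and turns \<open>D\<close>-submodules of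
  \<open>V\<close> into ideals of \<open>D\<close>.\<close>

lemma V_subset_integral_closure:
  assumes "noetherian_ring R"
  shows "V \<subseteq> integral_closure K D"
proof
  fix x assume x: "x \<in> V"
  then have xc: "x \<in> carrier K" using V_closed(1) by blast
  interpret N: noetherian_ring R by fact
  obtain m where m: "m \<in> M" "m \<noteq> \<zero>" by (rule M_nonzero)
  have mc: "m \<in> carrier K" using m M_closed(2) by blast
  \<comment> \<open>Values of coefficient lists of length exactly \<open>n\<close>, leading zeros
    allowed: \<open>L n\<close> is \<open>D + Dx + ... + Dx^(n-1)\<close>, and \<open>L 0\<close> is
    zero.\<close>
  define L where "L n = {eval p x | p. set p \<subseteq> D \<and> length p = n}" for n
  have L0: "L 0 = {\<zero>}" by (auto simp: L_def)
  have LSuc: "y \<in> L (Suc n) \<longleftrightarrow> (\<exists>d\<in>D. \<exists>z\<in>L n. y = d \<otimes> x [^] n \<oplus> z)" for y n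
  proof
    assume "y \<in> L (Suc n)"
    then obtain p where p: "set p \<subseteq> D" "length p = Suc n" "y = eval p x" unfolding L_def by blast
    then obtain d q where "p = d # q" by (cases p) auto
    then have "d \<in> D" "eval q x \<in> L n" "y = d \<otimes> x [^] n \<oplus> eval q x"
      using p by (auto simp: L_def)
    then show "\<exists>d\<in>D. \<exists>z\<in>L n. y = d \<otimes> x [^] n \<oplus> z" by blast
  next
    assume "\<exists>d\<in>D. \<exists>z\<in>L n. y = d \<otimes> x [^] n \<oplus> z"
    then obtain d q where "d \<in> D" "set q \<subseteq> D" "length q = n" "y = d \<otimes> x [^] n \<oplus> eval q x"
      unfolding L_def by blast
    then show "y \<in> L (Suc n)" unfolding L_def by (intro CollectI exI[of _ "d # q"]) auto
  qed
  have pow: "x [^] (n::nat) \<in> V" for n by (induction n) (use x V_closed(3,6) in auto)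
  have LV: "L n \<subseteq> V" for n
  proof (induction n)
    case (Suc n)
    show ?case
    proof
      fix y assume "y \<in> L (Suc n)"
      then obtain d z where "d \<in> D" "z \<in> L n" "y = d \<otimes> x [^] n \<oplus> z" unfolding LSuc by blast
      then show "y \<in> V"
        using V_closed(7)[OF V_closed(6)[OF subsetD[OF D_subset_V] pow] subsetD[OF Suc]] by simp
    qed
  qed (use L0 V_closed(2) in auto)
  have Lc: "y \<in> carrier K" if "y \<in> L n" for y n using that LV V_closed(1) by blast
  have Lz: "\<zero> \<in> L n" for n
  proof (induction n)
    case (Suc n)
    have "\<zero> = \<zero> \<otimes> x [^] n \<oplus> \<zero>" using xc by simp
    then show ?case unfolding LSuc using Suc D_closed(2) by blast
  qed (simp add: L0)
  have Ladd: "y \<oplus> z \<in> L n" if "y \<in> L n" "z \<in> L n" for y z n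
    using that
  proof (induction n arbitrary: y z)
    case (Suc n)
    then obtain d y' e z' where *: "d \<in> D" "e \<in> D" "y' \<in> L n" "z' \<in> L n"
      "y = d \<otimes> x [^] n \<oplus> y'" "z = e \<otimes> x [^] n \<oplus> z'" unfolding LSuc by blast
    then have "y \<oplus> z = (d \<oplus> e) \<otimes> x [^] n \<oplus> (y' \<oplus> z')"
      using Lc D_closed(1) xc by (simp add: l_distr a_ac subset_iff)
    then show ?case unfolding LSuc using * Suc.IH D_closed(7) by blast
  qed (simp add: L0)
  have Lmult: "d \<otimes> y \<in> L n" if "d \<in> D" "y \<in> L n" for d y n
    using that
  proof (induction n arbitrary: y)
    case (Suc n)
    then obtain e y' where *: "e \<in> D" "y' \<in> L n" "y = e \<otimes> x [^] n \<oplus> y'" unfolding LSuc by blast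
    then have "d \<otimes> y = (d \<otimes> e) \<otimes> x [^] n \<oplus> d \<otimes> y'"
      using Lc D_closed(1) xc Suc.prems(1) by (simp add: r_distr m_assoc subset_iff)
    then show ?case unfolding LSuc using * Suc D_closed(6) by blast
  qed (use L0 D_closed(1) in auto)
  have Linc: "L n \<subseteq> L (Suc n)" for n
  proof
    fix y assume y: "y \<in> L n"
    then have "y = \<zero> \<otimes> x [^] n \<oplus> y" using Lc xc by simp
    then show "y \<in> L (Suc n)" unfolding LSuc using y D_closed(2) by blast
  qed
  have Lmono: "L i \<subseteq> L j" if "i \<le> j" for i j using that Linc by (rule lift_Suc_mono_le[rotated])
  define I where "I n = (\<lambda>y. y \<otimes> m) ` L n" for n
  have Imono: "I i \<subseteq> I j" if "i \<le> j" for i j using Lmono[OF that] by (auto simp: I_def)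
  have Ii: "ideal (I n) R" for n
  proof (rule R.idealI_elementwise)
    show "I n \<subseteq> carrier R" using LV V_mult_M[OF _ m(1)] M_closed(1) by (auto simp: I_def)
    have "\<zero> = \<zero> \<otimes> m" using mc by simp
    then show "\<zero>\<^bsub>R\<^esub> \<in> I n" unfolding I_def using Lz by auto
    fix a b assume "a \<in> I n" "b \<in> I n"
    then obtain y z where *: "y \<in> L n" "z \<in> L n" "a = y \<otimes> m" "b = z \<otimes> m" unfolding I_def by blast
    then have "a \<oplus> b = (y \<oplus> z) \<otimes> m" using Lc mc by (simp add: l_distr)
    then show "a \<oplus>\<^bsub>R\<^esub> b \<in> I n" unfolding I_def using Ladd * by auto
  next
    fix r a assume "r \<in> carrier R" "a \<in> I n"
    then obtain y where *: "y \<in> L n" "a = y \<otimes> m" "r \<in> D" unfolding I_def by auto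
    then have "r \<otimes> a = (r \<otimes> y) \<otimes> m" using Lc mc D_closed(1) by (simp add: m_assoc subset_iff)
    then show "r \<otimes>\<^bsub>R\<^esub> a \<in> I n" unfolding I_def using Lmult * by auto
  qed
  have lin: "I i \<subseteq> I j \<or> I j \<subseteq> I i" for i j using Imono linear[of i j] by blast
  have "subset.chain {I. ideal I R} (range I)"
    unfolding subset_chain_def using Ii lin by blast
  then have "\<Union>(range I) \<in> range I" by (intro N.ideal_chain_is_trivial) auto
  then obtain n where n: "\<And>k. I k \<subseteq> I n" by blast
  \<comment> \<open>Stabilization at \<open>n\<close>, after cancelling \<open>m\<close>, expresses
    \<open>x [^] n\<close> by lower powers; moved to the other side, this is a monic equation of
    degree \<open>n\<close>.\<close>
  have "x [^] n = \<one> \<otimes> x [^] n \<oplus> \<zero>" using xc by simp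
  then have "x [^] n \<in> L (Suc n)" unfolding LSuc using D_closed(3) Lz by blast
  then have "x [^] n \<otimes> m \<in> I n" using n[of "Suc n"] by (auto simp: I_def)
  then obtain y where y: "y \<in> L n" "x [^] n \<otimes> m = y \<otimes> m" by (auto simp: I_def)
  then have "x [^] n \<in> L n" using m_rcancel[OF m(2) mc _ Lc[OF y(1)]] xc by simp
  then have "(\<ominus> \<one>) \<otimes> x [^] n \<in> L n" using Lmult D_closed(3,5) by blast
  then obtain p where p: "set p \<subseteq> D" "length p = n" "eval p x = \<ominus> (x [^] n)"
    using xc by (auto simp: L_def l_minus)
  have "eval (\<one> # p) x = \<zero>" using p xc by (simp add: r_neg)
  moreover have "polynomial\<^bsub>K\<^esub> D (\<one> # p)"
    using p D_closed(3) by (auto simp: polynomial_def)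
  ultimately show "x \<in> integral_closure K D"
    using xc unfolding integral_closure_def by (intro CollectI conjI exI[of _ "\<one> # p"]) auto
qed

text \<open>The opposite inclusion is a hypothesis because it has two sources: a uniformizer, or the
  assumption that the integral closure is a DVR with maximal ideal \<open>M\<close>.\<close>

lemma V_eq_integral_closure:
  assumes "noetherian_ring R" "integral_closure K D \<subseteq> V"
  shows "integral_closure K D = V"
  using V_subset_integral_closure[OF assms(1)] assms(2) by blast

text \<open>That \<open>M\<close> is an ideal of the integral closure says that the closure
  multiplies \<open>M\<close> into itself, which is membership in \<open>(M:M)\<close>.\<close>

lemma DVR_integral_closure_subset:
  assumes "DVR (K\<lparr>carrier := integral_closure K D\<rparr>) M"
  shows "integral_closure K D \<subseteq> V"
proof
  fix x assume x: "x \<in> integral_closure K D"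
  have "ideal M (K\<lparr>carrier := integral_closure K D\<rparr>)"
    using assms by (simp add: DVR_def local_ring_def maximalideal_def)
  then have "x \<otimes> m \<in> M" if "m \<in> M" for m
    using ideal.I_l_closed[of M "K\<lparr>carrier := integral_closure K D\<rparr>" m x] that x by simp
  then show "x \<in> V" using x by (auto simp: V_iff integral_closure_def)
qed

end

section \<open>Consequences of a uniformizer\<close>

context local_subdomain
begin

text \<open>The valuation of \<open>V\<close>. For a uniformizer \<open>p\<close>, zero has no such
  representation; its value is unspecified and zero is treated apart.\<close>

definition vord where
  "vord p x = (THE n. \<exists>u\<in>V_units. x = u \<otimes> p [^] (n::nat))"

section \<open>The discrete valuation attached to a uniformizer\<close>

context
  fixes p
  assumes unif: "uniformizer p"
begin

lemma p_facts: "p \<in> M" "p \<noteq> \<zero>" "p \<in> carrier K" "p \<in> D" "p \<in> V"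
  using unif M_closed(1,2) M_subset_V by (auto simp: uniformizer_def)

lemma M_rep: "x \<in> M \<Longrightarrow> x \<noteq> \<zero> \<Longrightarrow> \<exists>u\<in>V_units. \<exists>n. x = u \<otimes> p [^] Suc n"
  using unif unfolding uniformizer_def by blast

lemma p_pow_facts: "p [^] (n::nat) \<in> carrier K" "p [^] n \<noteq> \<zero>" "p [^] Suc n \<in> M"
proof -
  show "p [^] n \<in> carrier K" "p [^] n \<noteq> \<zero>" using p_facts nat_pow_nonzero by auto
  show "p [^] Suc n \<in> M"
  proof (induction n)
    case 0
    then show ?case using p_facts by simp
  next
    case (Suc n)
    then have "p [^] Suc n \<otimes> p \<in> M" using M_closed(1,5) p_facts by blast
    then show ?case by simp
  qed
qed

lemma unit_mult_pow_mem_M: "u \<in> V_units \<Longrightarrow> u \<otimes> p [^] Suc n \<in> M"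
  using V_units_closed(7) p_pow_facts(3) by blast

lemma rep_of_quotient:
  assumes x: "x \<in> carrier K" and uv: "u \<in> V_units" "v \<in> V_units"
    and eq: "x \<otimes> (v \<otimes> p [^] i) = u \<otimes> p [^] (j::nat)" and "i \<le> j"
  shows "\<exists>w\<in>V_units. \<exists>k. x = w \<otimes> p [^] (k::nat)"
proof -
  note c = V_units_closed(2,3)[OF uv(1)] V_units_closed(2,3)[OF uv(2)]
  have "p [^] j = p [^] (j - i) \<otimes> p [^] i"
    using p_facts \<open>i \<le> j\<close> by (simp add: nat_pow_mult)
  then have "(x \<otimes> v) \<otimes> p [^] i = (u \<otimes> p [^] (j - i)) \<otimes> p [^] i"
    using eq x c p_pow_facts(1) by (simp add: m_assoc)
  then have xv: "x \<otimes> v = u \<otimes> p [^] (j - i)"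
    using m_rcancel[OF p_pow_facts(2,1)[of i]] x c p_pow_facts(1) by (metis m_closed)
  have "x = x \<otimes> v \<otimes> inv v" using x c inv_facts[OF c(3,4)] by (simp add: m_assoc)
  also have "\<dots> = (u \<otimes> inv v) \<otimes> p [^] (j - i)"
    unfolding xv using c inv_facts(1)[OF c(3,4)] p_pow_facts(1) by (simp add: m_ac)
  finally show ?thesis using V_units_closed(6)[OF uv(1) V_units_closed(4)[OF uv(2)]] by blast
qed

lemma pow_rep_cases:
  assumes "w \<in> V_units"
  shows "w \<otimes> p [^] (k::nat) \<in> V_units \<or> w \<otimes> p [^] k \<in> M"
  using assms unit_mult_pow_mem_M[OF assms] V_units_closed(2)[OF assms] by (cases k) auto

text \<open>The three cases are positive, zero and negative valuation.\<close>

lemma field_cases: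
  assumes x: "x \<in> carrier K" "x \<noteq> \<zero>"
  shows "x \<in> M \<or> x \<in> V_units \<or> inv x \<in> M"
proof -
  obtain a b where ab: "a \<in> D" "b \<in> D" "b \<noteq> \<zero>" "x = a \<otimes> inv b"
    using quotient x unfolding quotient_field_def by blast
  have c: "a \<in> carrier K" "b \<in> carrier K" using ab D_closed(1) by auto
  note ib = inv_facts[OF c(2) ab(3)]
  have "a \<noteq> \<zero>" using ab x ib by auto
  \<comment> \<open>A uniformizer represents elements of \<open>M\<close>, while \<open>a\<close>
    and \<open>b\<close> may be units of \<open>D\<close>; so the fraction is expanded by
    \<open>p\<close>.\<close>
  then have nz: "a \<otimes> p \<noteq> \<zero>" "b \<otimes> p \<noteq> \<zero>" using ab c p_facts by (auto simp: integral_iff)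
  have "a \<otimes> p \<in> M" "b \<otimes> p \<in> M" using M_closed(5) ab p_facts by auto
  then obtain u v m n where *: "u \<in> V_units" "v \<in> V_units"
    "a \<otimes> p = u \<otimes> p [^] Suc m" "b \<otimes> p = v \<otimes> p [^] Suc n"
    using M_rep nz by metis
  have "x \<otimes> (b \<otimes> p) = a \<otimes> (inv b \<otimes> (b \<otimes> p))"
    unfolding ab(4) using c ib p_facts by (simp add: m_assoc)
  also have "\<dots> = a \<otimes> p" using ib(7) c p_facts by simp
  finally have eq: "x \<otimes> (v \<otimes> p [^] Suc n) = u \<otimes> p [^] Suc m" using * by simp
  have vc: "v \<otimes> p [^] Suc n \<in> carrier K"
    using V_units_closed(2)[OF *(2)] p_pow_facts(1) by blast
  have eq': "inv x \<otimes> (u \<otimes> p [^] Suc m) = v \<otimes> p [^] Suc n"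
    unfolding eq[symmetric] using inv_facts(7)[OF x vc] .
  note ix = inv_facts[OF x]
  show ?thesis
  proof (cases "n \<le> m")
    case True
    then obtain w k where "w \<in> V_units" "x = w \<otimes> p [^] (k::nat)"
      using rep_of_quotient[OF x(1) *(1,2) eq] by auto
    then show ?thesis using pow_rep_cases by blast
  next
    case False
    then obtain w k where "w \<in> V_units" "inv x = w \<otimes> p [^] (k::nat)"
      using rep_of_quotient[OF ix(1) *(2,1) eq'] by auto
    then have "inv x \<in> V_units \<or> inv x \<in> M" using pow_rep_cases by simp
    then show ?thesis using V_units_closed(4)[of "inv x"] ix(5) by auto
  qed
qed

lemma V_cases:
  assumes "x \<in> V"
  shows "x \<in> M \<or> x \<in> V_units"
proof (rule ccontr)
  assume no: "\<not> ?thesis"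
  have x: "x \<in> carrier K" "x \<noteq> \<zero>" using assms V_closed(1) no M_closed(3) by auto
  then have "inv x \<in> M" using field_cases no by blast
  then have "x \<otimes> inv x \<in> M" using V_mult_M[OF assms] by blast
  then show False using inv_facts(3)[OF x] one_notin_M by simp
qed

lemma V_rep:
  assumes "x \<in> V" "x \<noteq> \<zero>"
  obtains u and n :: nat where "u \<in> V_units" "x = u \<otimes> p [^] n"
proof -
  have "x = x \<otimes> p [^] (0::nat)" using assms V_closed(1) by auto
  then show thesis using that V_cases[OF assms(1)] M_rep[OF _ assms(2)] by metis
qed

text \<open>For \<open>m < n\<close>, cancelling \<open>p [^] m\<close> would turn the unit
  \<open>u\<close> into a unit times a positive power of \<open>p\<close>, an element of
  \<open>M\<close>.\<close>

lemma V_rep_unique: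
  assumes "u \<in> V_units" "v \<in> V_units" "u \<otimes> p [^] m = v \<otimes> p [^] (n::nat)"
  shows "m = n"
proof -
  have *: False if "u \<in> V_units" "v \<in> V_units" "u \<otimes> p [^] m = v \<otimes> p [^] n" "m < n"
    for u v and m n :: nat
  proof -
    note c = V_units_closed(2)[OF that(1)] V_units_closed(2)[OF that(2)]
    have "n = Suc (n - m - 1) + m" using \<open>m < n\<close> by simp
    then have "p [^] n = p [^] Suc (n - m - 1) \<otimes> p [^] m"
      using p_facts(3) by (metis nat_pow_mult)
    then have "u \<otimes> p [^] m = (v \<otimes> p [^] Suc (n - m - 1)) \<otimes> p [^] m"
      using that(3) c p_pow_facts(1) by (metis m_assoc)
    then have "u = v \<otimes> p [^] Suc (n - m - 1)"
      using m_rcancel[OF p_pow_facts(2,1)[of m] c(1)] c p_pow_facts(1) by (metis m_closed)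
    then show False using unit_mult_pow_mem_M[OF that(2)] V_units_closed(5)[OF that(1)] by metis
  qed
  show ?thesis using *[OF assms] *[OF assms(2,1) assms(3)[symmetric]] by (meson linorder_neqE_nat)
qed

lemma vord_eq:
  assumes "u \<in> V_units"
  shows "vord p (u \<otimes> p [^] n) = n"
  unfolding vord_def
proof (rule the_equality)
  show "\<exists>v\<in>V_units. u \<otimes> p [^] n = v \<otimes> p [^] n" using assms by blast
qed (use V_rep_unique assms in metis)

lemma vord_rep:
  assumes "x \<in> V" "x \<noteq> \<zero>"
  obtains u where "u \<in> V_units" "x = u \<otimes> p [^] vord p x"
proof -
  obtain u n where "u \<in> V_units" "x = u \<otimes> p [^] (n::nat)" using V_rep[OF assms] .
  then show thesis using that vord_eq by metis
qed

lemma vord_mult: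
  assumes "x \<in> V" "x \<noteq> \<zero>" "y \<in> V" "y \<noteq> \<zero>"
  shows "vord p (x \<otimes> y) = vord p x + vord p y"
proof -
  obtain u where u: "u \<in> V_units" "x = u \<otimes> p [^] vord p x" using vord_rep[OF assms(1,2)] .
  obtain v where v: "v \<in> V_units" "y = v \<otimes> p [^] vord p y" using vord_rep[OF assms(3,4)] .
  note c = V_units_closed(2)[OF u(1)] V_units_closed(2)[OF v(1)]
  have "x \<otimes> y = (u \<otimes> p [^] vord p x) \<otimes> (v \<otimes> p [^] vord p y)"
    using u(2) v(2) by simp
  also have "\<dots> = (u \<otimes> v) \<otimes> (p [^] vord p x \<otimes> p [^] vord p y)"
    using c p_pow_facts(1) by (simp add: m_ac)
  also have "\<dots> = (u \<otimes> v) \<otimes> p [^] (vord p x + vord p y)"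
    using p_facts by (simp add: nat_pow_mult)
  finally show ?thesis using vord_eq[OF V_units_closed(6)[OF u(1) v(1)]] by simp
qed

lemma vord_eq_0_iff:
  assumes "x \<in> V" "x \<noteq> \<zero>"
  shows "vord p x = 0 \<longleftrightarrow> x \<notin> M"
proof
  assume "vord p x = 0"
  then obtain u where "u \<in> V_units" "x = u \<otimes> p [^] (0::nat)" using vord_rep[OF assms] by metis
  then show "x \<notin> M" using V_units_closed(2,5) by auto
next
  assume "x \<notin> M"
  then have "x \<in> V_units" using V_cases assms by blast
  then show "vord p x = 0" using vord_eq[of x 0] V_units_closed(2) by auto
qed

text \<open>If the quotient \<open>z\<close> of \<open>y\<close> by \<open>x\<close> were outside
  \<open>V\<close>, its inverse would lie in \<open>M\<close>, and
  \<open>x = inv z \<otimes> y\<close> would have larger valuation than \<open>y\<close>.\<close>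

lemma vord_le_imp_divides:
  assumes "x \<in> V" "x \<noteq> \<zero>" "y \<in> V" "y \<noteq> \<zero>" "vord p x \<le> vord p y"
  shows "\<exists>v\<in>V. y = v \<otimes> x"
proof -
  have c: "x \<in> carrier K" "y \<in> carrier K" using assms V_closed(1) by auto
  note ix = inv_facts[OF c(1) assms(2)]
  define z where "z = y \<otimes> inv x"
  have z: "z \<in> carrier K" "z \<noteq> \<zero>" "y = z \<otimes> x"
    using c ix assms by (auto simp: z_def integral_iff m_assoc)
  have "z \<in> V"
  proof (rule ccontr)
    assume "z \<notin> V"
    then have zM: "inv z \<in> M"
      using field_cases[OF z(1,2)] M_subset_V V_units_closed(1) by blast
    have "inv z \<otimes> y = x" using inv_facts(7)[OF z(1,2) c(1)] z(3) by simp
    then have "vord p x = vord p (inv z) + vord p y"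
      using vord_mult[OF _ _ assms(3,4), of "inv z"] zM M_subset_V inv_facts(2)[OF z(1,2)] by auto
    then have "vord p (inv z) = 0" using assms(5) by simp
    then show False using vord_eq_0_iff[of "inv z"] zM M_subset_V inv_facts(2)[OF z(1,2)] by auto
  qed
  then show ?thesis using z by blast
qed

lemma uniformizer_imp_principal: "principal_domain RV"
proof -
  interpret RV: domain RV by (rule RV_domain)
  show ?thesis
  proof (intro principal_domain.intro principal_domain_axioms.intro RV_domain)
    fix I assume "ideal I RV"
    then have I: "I \<subseteq> V" "\<zero> \<in> I" "\<And>v x. v \<in> V \<Longrightarrow> x \<in> I \<Longrightarrow> v \<otimes> x \<in> I"
      unfolding V_ideal_iff by blast+
    have PI: "PIdl\<^bsub>RV\<^esub> a = {v \<otimes> a | v. v \<in> V}" for a by (auto simp: cgenideal_def)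
    show "\<exists>a\<in>carrier RV. I = PIdl\<^bsub>RV\<^esub> a"
    proof (cases "I \<subseteq> {\<zero>}")
      case True
      have "v \<otimes> \<zero> = \<zero>" if "v \<in> V" for v using that V_closed(1) by auto
      then have "PIdl\<^bsub>RV\<^esub> \<zero> \<subseteq> {\<zero>}" unfolding PI by auto
      moreover have "\<zero> = \<zero> \<otimes> \<zero>" by simp
      then have "\<zero> \<in> PIdl\<^bsub>RV\<^esub> \<zero>" unfolding PI using V_closed(2) by blast
      ultimately have "PIdl\<^bsub>RV\<^esub> \<zero> = {\<zero>}" by blast
      then show ?thesis using True I(2) V_closed(2) by (intro bexI[of _ \<zero>]) auto
    next
      case False
      \<comment> \<open>A nonzero element of least valuation divides every other element of
        \<open>I\<close>. The zero ideal has no such element and was treated before.\<close>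
      define x where "x = (ARG_MIN (vord p) x. x \<in> I \<and> x \<noteq> \<zero>)"
      have ex: "\<exists>x. x \<in> I \<and> x \<noteq> \<zero>" using False by blast
      have x: "x \<in> I" "x \<noteq> \<zero>" and min: "\<And>y. y \<in> I \<Longrightarrow> y \<noteq> \<zero> \<Longrightarrow> vord p x \<le> vord p y"
        using arg_min_natI[of "\<lambda>x. x \<in> I \<and> x \<noteq> \<zero>"] arg_min_nat_le[of "\<lambda>x. x \<in> I \<and> x \<noteq> \<zero>"] ex
        unfolding x_def by blast+
      have xV: "x \<in> V" using x I by blast
      have "I \<subseteq> PIdl\<^bsub>RV\<^esub> x"
      proof
        fix y assume y: "y \<in> I"
        show "y \<in> PIdl\<^bsub>RV\<^esub> x"
        proof (cases "y = \<zero>")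
          case True
          have "y = \<zero> \<otimes> x" using True x xV V_closed(1) by auto
          then show ?thesis using V_closed(2) unfolding PI by blast
        next
          case False
          have "\<exists>v\<in>V. y = v \<otimes> x"
            by (rule vord_le_imp_divides[OF xV x(2) _ False min[OF y False]]) (use y I in blast)
          then show ?thesis unfolding PI by blast
        qed
      qed
      moreover have "PIdl\<^bsub>RV\<^esub> x \<subseteq> I" unfolding PI using I(3) x by blast
      ultimately show ?thesis using xV by (intro bexI[of _ x]) auto
    qed
  qed
qed

lemma uniformizer_imp_local: "local_ring RV M"
proof -
  interpret RV: domain RV by (rule RV_domain)
  have ne: "V \<noteq> M" using V_closed(3) one_notin_M by auto
  have big: "I = V" if I: "ideal I RV" "\<not> I \<subseteq> M" for I
  proof -
    obtain x where x: "x \<in> I" "x \<notin> M" using I by blast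
    have IV: "I \<subseteq> V" "\<And>v x. v \<in> V \<Longrightarrow> x \<in> I \<Longrightarrow> v \<otimes> x \<in> I"
      using I(1) unfolding V_ideal_iff by blast+
    then have u: "x \<in> V_units" using V_cases x by blast
    have "inv x \<otimes> x \<in> I" using IV(2) x V_units_closed(1,4)[OF u] V_units_closed(1) by blast
    then have one: "\<one> \<in> I" using inv_facts(4)[OF V_units_closed(2,3)[OF u]] by simp
    have "v \<in> I" if "v \<in> V" for v using IV(2)[OF that one] that V_closed(1) by auto
    then show ?thesis using IV(1) by blast
  qed
  have max: "maximalideal M RV"
  proof (rule maximalidealI[OF M_ideal_V])
    show "carrier RV \<noteq> M" using ne by simp
    fix J assume "ideal J RV" "M \<subseteq> J"
    then show "J = M \<or> J = carrier RV" using big by auto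
  qed
  have "N = M" if N: "maximalideal N RV" for N
  proof -
    have "N \<noteq> V" "ideal N RV" using maximalideal.I_notcarr[OF N] N by (auto simp: maximalideal_def)
    then have "N \<subseteq> M" using big by blast
    then show ?thesis
      using maximalideal.I_maximal[OF N M_ideal_V] ne M_subset_V by auto
  qed
  then show ?thesis using max RV.is_cring unfolding local_ring_def by blast
qed

lemma uniformizer_imp_DVR: "DVR RV M"
  unfolding DVR_def using uniformizer_imp_principal uniformizer_imp_local RV_not_field by blast

section \<open>From a uniformizer back to the conditions on the domain\<close>

lemma uniformizer_imp_PVD: "PVD K D M"
proof -
  have "a divides\<^bsub>RV\<^esub> b \<or> b divides\<^bsub>RV\<^esub> a" if ab: "a \<in> V" "b \<in> V" for a b
  proof -
    have c: "a \<in> carrier K" "b \<in> carrier K" using ab V_closed(1) by auto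
    consider "a = \<zero>" | "b = \<zero>" | "a \<noteq> \<zero>" "b \<noteq> \<zero>" "vord p a \<le> vord p b"
      | "a \<noteq> \<zero>" "b \<noteq> \<zero>" "vord p b \<le> vord p a" by linarith
    then show ?thesis
    proof cases
      case 1
      then have "a = b \<otimes> \<zero>" using c by simp
      then show ?thesis using V_closed(2) by (auto simp: factor_def)
    next
      case 2
      then have "b = a \<otimes> \<zero>" using c by simp
      then show ?thesis using V_closed(2) by (auto simp: factor_def)
    next
      case 3
      then obtain v where v: "v \<in> V" "b = v \<otimes> a" using vord_le_imp_divides ab by blast
      then have "b = a \<otimes> v" using c V_closed(1) by (auto simp: m_comm)
      then show ?thesis using v by (auto simp: factor_def)
    next
      case 4
      then obtain v where v: "v \<in> V" "a = v \<otimes> b" using vord_le_imp_divides ab by blast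
      then have "a = b \<otimes> v" using c V_closed(1) by (auto simp: m_comm)
      then show ?thesis using v by (auto simp: factor_def)
    qed
  qed
  then have "valuation_domain RV" using RV_domain by (simp add: valuation_domain_def)
  then show ?thesis
    using quotient local uniformizer_imp_local unfolding PVD_def Let_def by blast
qed

lemma uniformizer_imp_ACCP: "ACCP R"
  unfolding ACCP_def
proof (intro allI impI)
  fix a :: "nat \<Rightarrow> 'a"
  assume aD: "\<forall>n. a n \<in> carrier R" and "\<forall>n. PIdl\<^bsub>R\<^esub> (a n) \<subseteq> PIdl\<^bsub>R\<^esub> (a (Suc n))"
  then have mono: "PIdl\<^bsub>R\<^esub> (a i) \<subseteq> PIdl\<^bsub>R\<^esub> (a j)" if "i \<le> j" for i j
    using that lift_Suc_mono_le[of "\<lambda>n. PIdl\<^bsub>R\<^esub> (a n)"] by blast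
  have aK: "a n \<in> D" "a n \<in> carrier K" "a n \<in> V" for n
    using aD D_closed(1) D_subset_V by auto
  have step: "\<exists>d\<in>D. a i = d \<otimes> a j" if "i \<le> j" for i j
  proof -
    have "a i \<in> PIdl\<^bsub>R\<^esub> (a i)" using R.cgenideal_self aK by simp
    then have "a i \<in> PIdl\<^bsub>R\<^esub> (a j)" using mono[OF that] by blast
    then show ?thesis by (simp add: PIdl_R_iff)
  qed
  show "\<exists>N. \<forall>n\<ge>N. PIdl\<^bsub>R\<^esub> (a n) = PIdl\<^bsub>R\<^esub> (a N)"
  proof (cases "\<forall>n. a n = \<zero>")
    case True
    then show ?thesis by auto
  next
    case False
    then obtain N0 where N0: "a N0 \<noteq> \<zero>" by blast
    have nz: "a n \<noteq> \<zero>" if n: "n \<ge> N0" for n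
    proof
      assume "a n = \<zero>"
      then show False using step[OF n] N0 D_closed(1) by auto
    qed
    \<comment> \<open>Generators before \<open>N0\<close> may be zero and have no valuation; from
      \<open>N0\<close> on all are nonzero.\<close>
    define N where "N = (ARG_MIN (\<lambda>n. vord p (a n)) n. n \<ge> N0)"
    have N: "N \<ge> N0"
      unfolding N_def by (rule arg_min_natI[of "\<lambda>n. n \<ge> N0" N0]) simp
    have min: "\<And>n. n \<ge> N0 \<Longrightarrow> vord p (a N) \<le> vord p (a n)"
      unfolding N_def by (rule arg_min_nat_le[of "\<lambda>n. n \<ge> N0"])
    have "PIdl\<^bsub>R\<^esub> (a n) = PIdl\<^bsub>R\<^esub> (a N)" if n: "n \<ge> N" for n
    proof
      show "PIdl\<^bsub>R\<^esub> (a N) \<subseteq> PIdl\<^bsub>R\<^esub> (a n)" using mono[OF n] .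
      obtain d where d: "d \<in> D" "a N = d \<otimes> a n" using step[OF n] by blast
      have dc: "d \<in> carrier K" "d \<in> V" using d D_closed(1) D_subset_V by auto
      have nN: "a N \<noteq> \<zero>" "a n \<noteq> \<zero>" using nz N n by auto
      then have d0: "d \<noteq> \<zero>" using d aK by auto
      have "vord p (a N) = vord p d + vord p (a n)" using vord_mult[OF dc(2) d0 aK(3) nN(2)] d by simp
      moreover have "vord p (a N) \<le> vord p (a n)" using min N n by simp
      ultimately have "vord p d = 0" by simp
      \<comment> \<open>Valuation zero places \<open>d\<close> outside \<open>M\<close>, and an
        element of \<open>D\<close> outside \<open>M\<close> is invertible in \<open>D\<close>, not
        just in \<open>V\<close>.\<close>
      then have "d \<notin> M" using vord_eq_0_iff[OF dc(2) d0] by blast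
      then have "inv d \<in> D" using inv_mem_D d by blast
      moreover have "a n = inv d \<otimes> a N" using d inv_facts(7)[OF dc(1) d0 aK(2)] by simp
      ultimately have "a n \<in> PIdl\<^bsub>R\<^esub> (a N)" unfolding PIdl_R_iff by blast
      moreover have "ideal (PIdl\<^bsub>R\<^esub> (a N)) R" using R.cgenideal_ideal aK by simp
      ultimately show "PIdl\<^bsub>R\<^esub> (a n) \<subseteq> PIdl\<^bsub>R\<^esub> (a N)" using R.cgenideal_minimal by blast
    qed
    then show ?thesis by blast
  qed
qed

text \<open>An element \<open>x\<close> of valuation one satisfies \<open>M \<subseteq> xV\<close>,
  so that \<open>M^2 \<subseteq> xVM \<subseteq> xM \<subseteq> I\<close>.\<close>

lemma vord_1_imp_TA_ideal:
  assumes I: "ideal I R" "I \<subseteq> M" and x: "x \<in> I" "x \<noteq> \<zero>" "vord p x = 1"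
  shows "TA_ideal I R"
proof (rule R.M_square_subset_imp_TA_ideal[OF I])
  show "ideal_prod R M M \<subseteq> I"
  proof (rule R.ideal_prod_subset[OF I(1)])
    fix y z assume yz: "y \<in> M" "z \<in> M"
    have c: "x \<in> carrier K" "y \<in> carrier K" "z \<in> carrier K" "x \<in> V" "y \<in> V"
      using yz x(1) I(2) M_closed(2) M_subset_V by auto
    have "\<exists>v\<in>V. y = v \<otimes> x"
    proof (cases "y = \<zero>")
      case True
      then have "y = \<zero> \<otimes> x" using c by simp
      then show ?thesis using V_closed(2) by blast
    next
      case False
      then have "vord p y \<noteq> 0" using vord_eq_0_iff[OF c(5)] yz by blast
      then show ?thesis using vord_le_imp_divides[OF c(4) x(2) c(5) False] x(3) by simp
    qed
    then obtain v where v: "v \<in> V" "y = v \<otimes> x" by blast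
    then have "y \<otimes> z = (v \<otimes> z) \<otimes> x" using c V_closed(1) by (simp add: m_ac subset_iff)
    moreover have "v \<otimes> z \<in> D" using V_mult_M[OF v(1) yz(2)] M_closed(1) by blast
    ultimately show "y \<otimes>\<^bsub>R\<^esub> z \<in> I" using R.ideal_closed(5)[OF I(1), of "v \<otimes> z" x] x(1) by simp
  qed
qed

text \<open>Induction on the valuation of some nonzero member of \<open>I\<close>, not necessarily
  the least one. If \<open>I\<close> has a member of valuation one, it is itself 2-absorbing.
  Otherwise \<open>p\<close> divides every member with a quotient still in \<open>M\<close>, so the
  2-absorbing ideal \<open>(p)\<close> splits off and the valuation of the witness drops by
  one.\<close>

lemma ideal_has_TA_factorization:
  assumes "ideal I R" "I \<subseteq> M" "x \<in> I" "x \<noteq> \<zero>" "vord p x = Suc n"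
  shows "has_TA_factorization R I"
  using assms
proof (induction n arbitrary: I x)
  case 0
  then have "TA_ideal I R" using vord_1_imp_TA_ideal by simp
  then show ?case using 0 R.proper_ideal_iff R.ideal_prod_one
    unfolding has_TA_factorization_def by (intro exI[of _ "[I]"]) auto
next
  case (Suc n)
  note I = Suc.prems(1,2) and x = Suc.prems(3,4,5)
  note Ic = R.ideal_closed[OF I(1), simplified]
  show ?case
  proof (cases "\<exists>y\<in>I. y \<noteq> \<zero> \<and> vord p y = 1")
    case True
    then have "TA_ideal I R" using vord_1_imp_TA_ideal I by blast
    then show ?thesis using I R.proper_ideal_iff R.ideal_prod_one
      unfolding has_TA_factorization_def by (intro exI[of _ "[I]"]) auto
  next
    case False
    have two: "\<exists>u\<in>V_units. \<exists>k. y = p \<otimes> (u \<otimes> p [^] Suc k)" if y: "y \<in> I" "y \<noteq> \<zero>" for y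
    proof -
      have yV: "y \<in> V" "y \<in> M" using y I M_subset_V by auto
      then have "vord p y \<noteq> 0" using vord_eq_0_iff y by blast
      moreover have "vord p y \<noteq> 1" using False y by blast
      ultimately obtain k where k: "vord p y = Suc (Suc k)" by (metis One_nat_def not0_implies_Suc)
      obtain u where u: "u \<in> V_units" "y = u \<otimes> p [^] vord p y" using vord_rep[OF yV(1) y(2)] .
      then have "y = p \<otimes> (u \<otimes> p [^] Suc k)"
        using k p_facts V_units_closed(2) p_pow_facts(1)[of k] by (simp add: m_ac)
      then show ?thesis using u by blast
    qed
    \<comment> \<open>The ideal \<open>I\<close> divided by \<open>p\<close>. It is contained in
      \<open>M\<close> because all nonzero members of \<open>I\<close> have valuation at least two;
      without this the remaining factor would not be proper.\<close>
    define J where "J = {y \<in> carrier K. p \<otimes> y \<in> I}"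
    have JM: "J \<subseteq> M"
    proof
      fix y assume y: "y \<in> J"
      then have yc: "y \<in> carrier K" "p \<otimes> y \<in> I" by (auto simp: J_def)
      show "y \<in> M"
      proof (cases "y = \<zero>")
        case True
        then show ?thesis using M_closed(3) by simp
      next
        case False
        then have "p \<otimes> y \<noteq> \<zero>" using yc p_facts by (simp add: integral_iff)
        then obtain u k where u: "u \<in> V_units" "p \<otimes> y = p \<otimes> (u \<otimes> p [^] Suc k)"
          using two[OF yc(2)] by blast
        have "u \<otimes> p [^] Suc k \<in> M" using unit_mult_pow_mem_M u by blast
        then show ?thesis using u(2) m_lcancel[OF p_facts(2,3) yc(1)] M_closed(2) by metis
      qed
    qed
    have Ji: "ideal J R"
    proof (rule R.idealI_elementwise)
      show "J \<subseteq> carrier R" using JM M_closed(1) by auto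
      show "\<zero>\<^bsub>R\<^esub> \<in> J" using Ic(2) p_facts by (simp add: J_def)
      show "a \<oplus>\<^bsub>R\<^esub> b \<in> J" if "a \<in> J" "b \<in> J" for a b
        using that Ic(3) p_facts by (simp add: J_def r_distr)
      show "r \<otimes>\<^bsub>R\<^esub> a \<in> J" if "r \<in> carrier R" "a \<in> J" for r a
      proof -
        have c: "r \<in> D" "r \<in> carrier K" "a \<in> carrier K" "p \<otimes> a \<in> I"
          using that D_closed(1) by (auto simp: J_def)
        then have "p \<otimes> (r \<otimes> a) = r \<otimes> (p \<otimes> a)" using p_facts by (simp add: m_ac)
        then show ?thesis using Ic(5)[OF c(1,4)] c by (simp add: J_def)
      qed
    qed
    obtain u k where u: "u \<in> V_units" "x = p \<otimes> (u \<otimes> p [^] Suc k)" using two x by blast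
    define y where "y = u \<otimes> p [^] Suc k"
    have yc: "y \<in> carrier K" "y \<in> M" "x = p \<otimes> y"
      using unit_mult_pow_mem_M[OF u(1)] M_closed(2) u(2) by (auto simp: y_def)
    have y0: "y \<noteq> \<zero>" using x(2) yc p_facts by auto
    have yJ: "y \<in> J" using yc x(1) by (simp add: J_def)
    have "vord p p = 1" using vord_eq[OF one_V_units, of 1] p_facts by simp
    then have "vord p y = Suc n"
      using vord_mult[OF p_facts(5,2) _ y0] yc x(3) M_subset_V by auto
    then have "has_TA_factorization R J" using Suc.IH[OF Ji JM yJ y0] by blast
    then obtain Js where Js: "\<forall>J\<in>set Js. proper_ideal J R \<and> TA_ideal J R"
      "J = ideal_prod_list R Js" unfolding has_TA_factorization_def by blast
    let ?P = "PIdl\<^bsub>R\<^esub> p"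
    have P: "ideal ?P R" "?P \<subseteq> M" "p \<in> ?P"
      using R.cgenideal_ideal R.cgenideal_minimal[OF R.M_ideal] R.cgenideal_self p_facts by auto
    have TA: "TA_ideal ?P R" using vord_1_imp_TA_ideal[OF P p_facts(2)] \<open>vord p p = 1\<close> by blast
    have "I = ideal_prod R ?P J"
    proof
      show "ideal_prod R ?P J \<subseteq> I"
      proof (rule R.ideal_prod_subset[OF I(1)])
        fix a b assume "a \<in> ?P" "b \<in> J"
        then obtain d where d: "d \<in> D" "a = d \<otimes> p" "b \<in> carrier K" "p \<otimes> b \<in> I"
          by (auto simp: PIdl_R_iff J_def)
        then have "a \<otimes> b = d \<otimes> (p \<otimes> b)" using p_facts D_closed(1) by (auto simp: m_assoc)
        then show "a \<otimes>\<^bsub>R\<^esub> b \<in> I" using Ic(5)[OF d(1,4)] by simp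
      qed
      show "I \<subseteq> ideal_prod R ?P J"
      proof
        fix z assume z: "z \<in> I"
        have "\<exists>w\<in>carrier K. z = p \<otimes> w"
        proof (cases "z = \<zero>")
          case True
          then have "z = p \<otimes> \<zero>" using p_facts by simp
          then show ?thesis by blast
        next
          case False
          then obtain u k where "u \<in> V_units" "z = p \<otimes> (u \<otimes> p [^] Suc k)" using two[OF z] by blast
          then show ?thesis using unit_mult_pow_mem_M M_closed(2) by blast
        qed
        then obtain w where "w \<in> carrier K" "z = p \<otimes> w" by blast
        then have "w \<in> J" "z = p \<otimes> w" using z by (auto simp: J_def)
        then show "z \<in> ideal_prod R ?P J" using ideal_prod.prod[OF P(3), of w J R] by simp
      qed
    qed
    then have "I = ideal_prod_list R (?P # Js)" using Js(2) by simp
    then show ?thesis using Js(1) TA P R.proper_ideal_iff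
      unfolding has_TA_factorization_def by (intro exI[of _ "?P # Js"]) auto
  qed
qed

lemma uniformizer_imp_TAF: "TAF_domain R"
  unfolding TAF_domain_def
proof (intro conjI allI impI R.domain_axioms)
  fix I assume "proper_ideal I R"
  then have I: "ideal I R" "I \<subseteq> M" using R.proper_ideal_iff by auto
  show "has_TA_factorization R I"
  proof (cases "I \<subseteq> {\<zero>}")
    \<comment> \<open>The zero ideal offers no valuation; it is 2-absorbing because there are no
      zero divisors, and so is its own factorization.\<close>
    case True
    then have "I = {\<zero>\<^bsub>R\<^esub>}" using R.ideal_closed(2)[OF I(1)] by auto
    moreover have "TA_ideal {\<zero>\<^bsub>R\<^esub>} R"
      unfolding TA_ideal_def using R.zeroideal D_closed(1) by (auto simp: integral_iff subset_iff)
    ultimately show ?thesis using I R.proper_ideal_iff R.ideal_prod_one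
      unfolding has_TA_factorization_def by (intro exI[of _ "[I]"]) auto
  next
    case False
    then obtain x where x: "x \<in> I" "x \<noteq> \<zero>" by blast
    then have "x \<in> M" "x \<in> V" using I M_subset_V by auto
    then obtain n where "vord p x = Suc n" using vord_eq_0_iff x not0_implies_Suc by blast
    then show ?thesis using ideal_has_TA_factorization[OF I x] by blast
  qed
qed

text \<open>The usual reason why valuation rings are integrally closed: for \<open>x\<close> outside
  \<open>V\<close> the inverse \<open>y\<close> lies in \<open>M\<close>, and a monic equation for
  \<open>x\<close>, multiplied by a power of \<open>y\<close>, puts \<open>\<one>\<close> into
  \<open>M\<close>.\<close>

lemma uniformizer_imp_integral_closure_subset: "integral_closure K D \<subseteq> V"
proof
  fix x assume "x \<in> integral_closure K D"
  then obtain q where x: "x \<in> carrier K" and q: "q \<noteq> []" "polynomial\<^bsub>K\<^esub> D q" "hd q = \<one>" "eval q x = \<zero>"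
    unfolding integral_closure_def by blast
  then obtain r where r: "q = \<one> # r" by (cases q) auto
  have rD: "set r \<subseteq> D" using q(2) r by (auto simp: polynomial_def)
  show "x \<in> V"
  proof (rule ccontr)
    assume xV: "x \<notin> V"
    then have x0: "x \<noteq> \<zero>" using V_closed(2) by auto
    note ix = inv_facts[OF x x0]
    define y where "y = inv x"
    have y: "y \<in> M" "y \<in> carrier K" "x \<otimes> y = \<one>"
      using field_cases[OF x x0] xV M_subset_V V_units_closed(1) ix by (auto simp: y_def)
    have ec: "eval s x \<in> carrier K" if "set s \<subseteq> D" for s
      using that D_closed(1) x by (intro eval_in_carrier) auto
    have xy: "x [^] n \<otimes> y [^] n = \<one>" for n :: nat
      using nat_pow_distrib[OF x y(2), of n] y(3) by simp
    \<comment> \<open>A list of length \<open>k\<close> has degree below \<open>k\<close>. After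
      multiplication by \<open>y [^] k\<close> each coefficient carries a positive power of
      \<open>y\<close>, so the sum lies in \<open>M\<close>.\<close>
    have "eval s x \<otimes> y [^] length s \<in> M" if "set s \<subseteq> D" for s
      using that
    proof (induction s)
      case Nil
      then show ?case using M_closed(3) by simp
    next
      case (Cons a s)
      let ?k = "length s"
      have c: "a \<in> carrier K" "eval s x \<in> carrier K" "a \<in> D" using Cons D_closed(1) ec by auto
      have "eval (a # s) x \<otimes> y [^] length (a # s) =
          (a \<otimes> x [^] ?k) \<otimes> (y [^] ?k \<otimes> y) \<oplus> eval s x \<otimes> (y [^] ?k \<otimes> y)"
        using c x y by (simp add: l_distr)
      also have "\<dots> = (a \<otimes> y) \<otimes> (x [^] ?k \<otimes> y [^] ?k) \<oplus> y \<otimes> (eval s x \<otimes> y [^] ?k)"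
        using c x y by (simp add: m_ac)
      also have "\<dots> = a \<otimes> y \<oplus> y \<otimes> (eval s x \<otimes> y [^] ?k)"
        using xy c y by simp
      finally show ?case
        using Cons M_closed(4)[OF M_closed(5)[OF c(3) y(1)] M_closed(5)[OF M_closed(1)[OF y(1)]]]
        by simp
    qed
    then have m: "eval r x \<otimes> y [^] length r \<in> M" (is "?m \<in> M") using rD .
    \<comment> \<open>The exponent \<open>length r\<close> is the degree of the monic
      \<open>q\<close>, so its leading term becomes exactly \<open>\<one>\<close>.\<close>
    have "\<zero> = eval q x \<otimes> y [^] length r" using q(4) y by simp
    also have "\<dots> = x [^] length r \<otimes> y [^] length r \<oplus> ?m"
      using r x y ec[OF rD] by (simp add: l_distr)
    finally have "\<one> \<oplus> ?m = \<zero>" using xy by simp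
    then have "\<one> = \<ominus> ?m" using sum_zero_eq_neg[of \<one> ?m] m M_closed(2) by simp
    then show False using M_closed(6)[OF m] one_notin_M by simp
  qed
qed

end

end

section \<open>The circles of implications through the existence of a uniformizer\<close>

theorem theorem4p3:
  fixes K :: "('a, 'b) ring_scheme" and D M :: "'a set"
  defines "R \<equiv> K\<lparr>carrier := D\<rparr>"
  assumes "quotient_field K D"
    and "local_ring R M"
    and "\<not> field R"
  defines "a \<equiv> TAF_domain R"
    and "b \<equiv> krull_dim R = 1 \<and>
              (\<forall>x\<in>carrier R. proper_ideal (PIdl\<^bsub>R\<^esub> x) R \<longrightarrow> has_TA_factorization R (PIdl\<^bsub>R\<^esub> x))"
    and "c \<equiv> atomic R \<and> krull_dim R = 1 \<and> (\<forall>x. atom R x \<longrightarrow> TA_ideal (PIdl\<^bsub>R\<^esub> x) R)"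
    and "d \<equiv> atomic R \<and> universal_ideal R (ideal_prod R M M)"
    and "e \<equiv> atomic R \<and> PVD K D M"
    and "f \<equiv> PVD K D M \<and> ACCP R"
    and "g \<equiv> DVR (K\<lparr>carrier := self_colon K M\<rparr>) M"
    and "h \<equiv> DVR (K\<lparr>carrier := integral_closure K D\<rparr>) M"
  shows "(a \<longleftrightarrow> b) \<and> (a \<longleftrightarrow> c) \<and> (a \<longleftrightarrow> d) \<and> (a \<longleftrightarrow> e) \<and> (a \<longleftrightarrow> f) \<and> (a \<longleftrightarrow> g) \<and>
         (noetherian_ring R \<longrightarrow> (a \<longleftrightarrow> h))"
proof -
  have "local_subdomain K D M"
    using assms(2-4) unfolding R_def quotient_field_def local_subdomain_def local_subdomain_axioms_def
    by blast
  then interpret local_subdomain K D M .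
  \<comment> \<open>Two circles meet in \<open>u\<close>: one runs through \<open>a\<close>,
    \<open>b\<close>, \<open>c\<close>, \<open>d\<close> and the other through \<open>f\<close>,
    \<open>e\<close>, \<open>d\<close>. Condition \<open>g\<close> is attached to \<open>u\<close>
    directly.\<close>
  define u where "u \<longleftrightarrow> (\<exists>p. uniformizer p)"
  have ab: "a \<Longrightarrow> b"
    unfolding a_def b_def R_def using R.TAF_domain_imp_krull_dim by (simp add: TAF_domain_def)
  have bc: "b \<Longrightarrow> c"
    unfolding b_def c_def R_def using R.principal_TA_factorization_imp_atoms by blast
  have cd: "c \<Longrightarrow> d"
    unfolding c_def d_def R_def using R.TA_atoms_imp_universal by blast
  have du: u if d
  proof -
    have "atomic (K\<lparr>carrier := D\<rparr>)"
      "universal_ideal (K\<lparr>carrier := D\<rparr>) (ideal_prod (K\<lparr>carrier := D\<rparr>) M M)"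
      using that unfolding d_def R_def by auto
    then obtain p where "uniformizer p" by (rule atomic_universal_imp_uniformizer)
    then show u unfolding u_def by blast
  qed
  have ed: "e \<Longrightarrow> d"
    unfolding e_def d_def R_def using PVD_imp_universal by blast
  have fe: "f \<Longrightarrow> e"
    unfolding f_def e_def R_def using R.ACCP_imp_atomic by blast
  have ua: "u \<Longrightarrow> a"
    unfolding u_def a_def R_def using uniformizer_imp_TAF by blast
  have uf: "u \<Longrightarrow> f"
    unfolding u_def f_def R_def using uniformizer_imp_PVD uniformizer_imp_ACCP by blast
  have ug: "u \<longleftrightarrow> g"
  proof
    show "u \<Longrightarrow> g" unfolding u_def g_def using uniformizer_imp_DVR by blast
    assume g
    then obtain p where "uniformizer p" unfolding g_def by (rule DVR_imp_uniformizer)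
    then show u unfolding u_def by blast
  qed
  \<comment> \<open>Each of \<open>g\<close> and \<open>h\<close> forces the integral closure to
    equal \<open>(M:M)\<close>; after that both say the same.\<close>
  have gh: "g \<longleftrightarrow> h" if N: "noetherian_ring R"
  proof
    assume g
    then have "integral_closure K D \<subseteq> self_colon K M"
      using ug uniformizer_imp_integral_closure_subset unfolding u_def by blast
    then have "integral_closure K D = self_colon K M" using V_eq_integral_closure N unfolding R_def by blast
    then show h using \<open>g\<close> unfolding g_def h_def by simp
  next
    assume h
    then have "integral_closure K D = self_colon K M"
      using V_eq_integral_closure DVR_integral_closure_subset N unfolding h_def R_def by blast
    then show g using \<open>h\<close> unfolding g_def h_def by simp
  qed
  show ?thesis using ab bc cd du ed fe ua uf ug gh by blast
qed

end
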